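(* Let $d\geq 2$ be an integer, let $c_1,\dots,c_s\in\mathbb{Z}$ be distinct, and let $G=\langle x^d+c_1,\dots,x^d+c_s\rangle$ be the semigroup generated by these polynomials under composition. Assume that $s\geq 3$ if $d\geq 5$ is odd and that $s\geq 5$ if $d\geq 4$ is even (no assumption on $s$ is made when $d\in\{2,3\}$). Then $G$ contains a positive proportion of irreducible polynomials over $\mathbb{Q}$ if and only if $G$ contains at least one polynomial that is irreducible over $\mathbb{Q}$.
   Context: For polynomials $f_1,\dots,f_s\in\mathbb{Q}[x]$, $\langle f_1,\dots,f_s\rangle$ denotes the set of all finite nonempty compositions of the $f_i$ (with repetition allowed). Such a semigroup $G$ contains a positive proportion of irreducible polynomials over $\mathbb{Q}$ if $$\liminf_{B\to\infty}\frac{\#\{g\in G:\deg(g)\leq B\text{ and }g\text{ is irreducible over }\mathbb{Q}\}}{\#\{g\in G:\deg(g)\leq B\}}>0.$$ *)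

theory Defs
  imports
    Complex_Main
    "HOL-Computational_Algebra.Polynomial_Factorial"
    "HOL-Library.Extended_Real"
    "HOL-Library.Liminf_Limsup"
begin

inductive_set compositional_semigroup :: "'a::comm_semiring_0 poly set \<Rightarrow> 'a poly set"
  for F :: "'a poly set" where
  generator: "f \<in> F \<Longrightarrow> f \<in> compositional_semigroup F"
| compose: "f \<in> compositional_semigroup F \<Longrightarrow> g \<in> compositional_semigroup F \<Longrightarrow>
    pcompose f g \<in> compositional_semigroup F"

text \<open>
  The liminf is taken in the extended reals, a complete lattice. In the intended setting the
  generators have degree at least 2, so \<open>G\<close> has only finitely many elements of each bounded degree
  and both cardinalities are genuine counts. For the finitely many \<open>B\<close> below the least degree in
  \<open>G\<close> the quotient is \<open>0 / 0 = 0\<close>, which does not affect the liminf.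
\<close>

definition positive_proportion_irreducible :: "rat poly set \<Rightarrow> bool" where
  "positive_proportion_irreducible G \<longleftrightarrow>
    liminf (\<lambda>B::nat. ereal
      (real (card {g \<in> G. degree g \<le> B \<and> irreducible g}) / real (card {g \<in> G. degree g \<le> B}))) > 0"

end

theory Submission
  imports Defs
    "HOL-Computational_Algebra.Computational_Algebra"
    "HOL-Computational_Algebra.Field_as_Ring"
begin

text \<open>
  Record a composition of the polynomials \<open>x ^ d + c\<close> by the word of its constants, outermost
  letter first. An irreducible composition has an irreducible outermost letter, so the question is
  how an irreducible \<open>x ^ d + a\<close> can be extended on the right.

  Extension is governed by a norm criterion. Let \<open>F\<close> be the composition of the word \<open>a # u\<close>,
  suppose that it is irreducible, and append the letter \<open>c\<close>. If the result \<open>F(x ^ d + c)\<close> is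
  reducible, then Capelli's theorem writes a translated root of \<open>F\<close> as a \<open>p\<close>-th power for some prime
  \<open>p\<close> dividing \<open>d\<close>, and taking norms makes the integer \<open>F(c) = t ^ d + a\<close> a \<open>p\<close>-th power, where \<open>t\<close>
  is the value of \<open>u\<close> at \<open>c\<close> (lemma \<open>irreducible_word_append_letter\<close>). Since \<open>t ^ d\<close> is a \<open>p\<close>-th
  power itself and neighbouring \<open>p\<close>-th powers are far apart, this cannot happen once
  \<open>\<bar>t\<bar> \<ge> \<bar>a\<bar>\<close> (lemma \<open>avoids_powers_large\<close>).

  It therefore suffices to find one word \<open>v\<close> for which the composition of \<open>a # v\<close> is irreducible and
  whose values at all integers in question are harmless: then every word that begins with \<open>a # v\<close>
  gives an irreducible polynomial. Distinct words give distinct polynomials, so these words are a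
  positive proportion (lemma \<open>positive_proportion_if_cone\<close>).

  In the main case the word \<open>v\<close> starts with three letters \<open>a\<close>. If the third iterate of \<open>x ^ d + a\<close> takes a value of
  size less than \<open>\<bar>a\<bar>\<close> at an integer \<open>n\<close>, then \<open>n\<close> is, up to sign, a fixed point \<open>b\<close> of
  \<open>x ^ d + a\<close>, so \<open>a = b - b ^ d\<close>, or \<open>d = 2\<close> and \<open>n\<close> lies up to sign on a cycle of length two
  (lemmas \<open>small_third_iterate_is_fixed\<close> and \<open>small_third_iterate_quadratic\<close>). What follows in \<open>v\<close>
  only has to steer the integers away from these few points. Another letter \<open>c\<close> does this unless
  \<open>c\<close> is tied to \<open>b\<close> by one of the equations \<open>c = b\<close>, or for even \<open>d\<close> also \<open>c = - b\<close> and
  \<open>c = - b - b ^ d\<close>; a large enough supply of letters contains one that is not. This is the source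
  of the lower bounds on the number of generators.

  In degrees two and three no supply is assumed. If the letters at hand are tied to \<open>b\<close>, then either
  the orbits of the constants never reach the dangerous points, or one of two pairs is present for
  which the norm criterion is silent: \<open>b - b ^ 3\<close> and \<open>b\<close> in degree three, and \<open>b - b ^ 2\<close> and \<open>- b\<close>
  with \<open>b\<close> a square in degree two. For these, irreducibility of one more composition is proved by
  hand, in degree three by evaluating at \<open>q\<close>-adic approximations of a root and comparing valuations
  (lemma \<open>irreducible_iterate_append\<close>), in degree two by a Diophantine equation
  (lemma \<open>irreducible_second_iterate_append\<close>).
\<close>

section \<open>Products over the roots of a rational polynomial\<close>

abbreviation cpx :: "rat poly \<Rightarrow> complex poly" where
  "cpx \<equiv> map_poly of_rat"

lemma cpx_simps [simp]:
  "cpx (p + q) = cpx p + cpx q" "cpx (p - q) = cpx p - cpx q" "cpx (p * q) = cpx p * cpx q"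
  "cpx (pCons a p) = pCons (of_rat a) (cpx p)" "cpx 1 = 1" "cpx (smult a p) = smult (of_rat a) (cpx p)"
  by (auto simp: poly_eq_iff coeff_map_poly of_rat_add of_rat_diff of_rat_mult coeff_mult of_rat_sum coeff_pCons
        split: nat.splits)

lemma cpx_power [simp]: "cpx (p ^ n) = cpx p ^ n"
  by (induction n) auto

lemma degree_cpx [simp]: "degree (cpx p) = degree p"
  by (rule degree_map_poly) auto

lemma cpx_eq_0 [simp]: "cpx p = 0 \<longleftrightarrow> p = 0"
  by (auto simp: poly_eq_iff coeff_map_poly)

lemma cpx_pcompose [simp]: "cpx (pcompose p q) = pcompose (cpx p) (cpx q)"
  by (induction p) (auto simp: pcompose_pCons)

lemma cpx_linear_factors:
  assumes "lead_coeff p = 1"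
  shows "cpx p = (\<Prod>x\<in>#proots (cpx p). [:-x, 1:])"
  using complex_poly_decompose_multiset[of "cpx p"] assms by (simp add: coeff_map_poly)

lemma poly_cpx_eq_prod:
  assumes "lead_coeff p = 1"
  shows "poly (cpx p) y = (\<Prod>x\<in>#proots (cpx p). y - x)"
  by (subst cpx_linear_factors[OF assms]) (simp add: poly_prod_mset image_mset.compositionality o_def)

lemma prod_mset_in_Rats:
  "(\<And>x. x \<in># A \<Longrightarrow> f x \<in> \<rat>) \<Longrightarrow> (\<Prod>x\<in>#A. f x :: complex) \<in> \<rat>"
  by (induction A) auto

lemma root_cpx_mod:
  assumes "poly (cpx q) y = 0" shows "poly (cpx (p mod q)) y = poly (cpx p) y"
proof -
  have "cpx p = cpx (p div q) * cpx q + cpx (p mod q)"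
    by (metis cpx_simps(1,3) div_mult_mod_eq)
  then show ?thesis using assms by simp
qed

text \<open>
  This is the resultant of \<open>p\<close> and \<open>q\<close>, and the induction is Euclid's algorithm: exchanging the
  roles of the two polynomials costs only a rational factor, and at the roots of \<open>q\<close> the polynomial
  \<open>p\<close> may be reduced modulo \<open>q\<close>.
\<close>

lemma prod_over_roots_in_Rats:
  assumes "lead_coeff p = 1"
  shows "(\<Prod>x\<in>#proots (cpx p). poly (cpx q) x) \<in> \<rat>"
  using assms
proof (induction "degree q" arbitrary: p q rule: less_induct)
  case less
  show ?case
  proof (cases "degree q = 0")
    case True
    then obtain c where "q = [:c:]" by (elim degree_eq_zeroE)
    then show ?thesis by (auto intro!: prod_mset_in_Rats)
  next
    case False
    define l where "l = lead_coeff q"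
    define r where "r = smult (inverse l) q"
    have l: "l \<noteq> 0" using False by (auto simp: l_def)
    have qr: "q = smult l r" using l by (simp add: r_def)
    have r: "lead_coeff r = 1" "degree r = degree q" using l by (auto simp: r_def l_def)
    let ?A = "proots (cpx p)" and ?B = "proots (cpx r)"
    have IH: "(\<Prod>y\<in>#?B. poly (cpx (p mod r)) y) \<in> \<rat>"
      by (rule less(1)) (use r False degree_mod_less'[of r p] in \<open>auto simp: mod_eq_0_iff_dvd\<close>, metis degree_0 degree_mod_less less_nat_zero_code not_gr_zero)
    have "r \<noteq> 0" using r by auto
    have eq: "image_mset (poly (cpx (p mod r))) ?B = image_mset (poly (cpx p)) ?B"
      by (rule image_mset_cong) (use \<open>r \<noteq> 0\<close> in \<open>auto intro!: root_cpx_mod\<close>)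
    \<comment> \<open>exchange the two root multisets in the product of all differences of roots\<close>
    have "(\<Prod>x\<in>#?A. poly (cpx q) x) = (\<Prod>x\<in>#?A. of_rat l * (\<Prod>y\<in>#?B. x - y))"
      by (simp add: qr poly_cpx_eq_prod[OF r(1)])
    also have "\<dots> = (\<Prod>x\<in>#?A. of_rat l) * (\<Prod>x\<in>#?A. \<Prod>y\<in>#?B. (-1) * (y - x))"
      by (subst prod_mset.distrib) simp
    also have "(\<Prod>x\<in>#?A. \<Prod>y\<in>#?B. (-1) * (y - x)) =
        (\<Prod>x\<in>#?A. \<Prod>y\<in>#?B. (-1)) * (\<Prod>x\<in>#?A. \<Prod>y\<in>#?B. y - x)"
      by (subst prod_mset.distrib)+ rule
    also have "(\<Prod>x\<in>#?A. \<Prod>y\<in>#?B. y - x) = (\<Prod>y\<in>#?B. \<Prod>x\<in>#?A. y - x)"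
      by (rule prod_mset.swap)
    also have "\<dots> = (\<Prod>y\<in>#?B. poly (cpx (p mod r)) y)"
      unfolding eq by (intro arg_cong[where f = prod_mset] image_mset_cong) (simp add: poly_cpx_eq_prod[OF less(2)])
    finally show ?thesis using IH by (auto intro!: Rats_mult prod_mset_in_Rats)
  qed
qed

text \<open>
  The polynomial agrees with its rational interpolation polynomial; the induction removes one
  interpolation node at a time.
\<close>

lemma rat_coeffs_if_rat_values:
  fixes p :: "complex poly"
  assumes "infinite S" "\<And>x. x \<in> S \<Longrightarrow> poly p (of_rat x) \<in> \<rat>"
  shows "\<exists>q. p = cpx q"
  using assms
proof (induction "degree p" arbitrary: p S)
  case 0
  obtain s where "s \<in> S" using 0(2) by (metis finite.emptyI ex_in_conv)
  moreover obtain c where "p = [:c:]" using 0(1) by (metis degree_eq_zeroE)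
  ultimately have "c \<in> \<rat>" using 0(3)[of s] by simp
  then obtain c' where "c = of_rat c'" by (auto elim: Rats_cases)
  then show ?case using \<open>p = [:c:]\<close> by (intro exI[of _ "[:c':]"]) simp
next
  case (Suc n)
  obtain s where s: "s \<in> S" using Suc(3) by (metis finite.emptyI ex_in_conv)
  then obtain c where c: "poly p (of_rat s) = of_rat c" using Suc(4) by (auto elim: Rats_cases)
  have "poly (p - [:of_rat c:]) (of_rat s) = 0" using c by simp
  then obtain r where r: "p - [:of_rat c:] = [:-of_rat s, 1:] * r"
    by (metis poly_eq_0_iff_dvd dvdE)
  then have pr: "p = [:-of_rat s, 1:] * r + [:of_rat c:]" by (simp add: algebra_simps)
  have r0: "r \<noteq> 0" using Suc(2) pr by auto
  have "degree p = degree ([:-of_rat s, 1:] * r)"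
    by (subst pr, subst degree_add_eq_left) (use r0 in \<open>auto simp: degree_mult_eq simp del: mult_pCons_left\<close>)
  then have "degree r = n" using Suc(2) r0 by (simp add: degree_mult_eq del: mult_pCons_left)
  moreover have "poly r (of_rat x) \<in> \<rat>" if x: "x \<in> S - {s}" for x
  proof -
    obtain d where "poly p (of_rat x) = of_rat d" using Suc(4) x by (auto elim: Rats_cases)
    moreover have "poly p (of_rat x) = (of_rat x - of_rat s) * poly r (of_rat x) + of_rat c"
      by (subst pr) (simp add: algebra_simps)
    moreover have "of_rat x - of_rat s \<noteq> (0::complex)" using x by simp
    ultimately have "poly r (of_rat x) = (of_rat d - of_rat c) / (of_rat x - of_rat s)"
      by (simp add: field_simps)
    then show ?thesis by auto
  qed
  ultimately obtain r' where "r = cpx r'"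
    using Suc(1)[of r "S - {s}"] Suc(3) by auto
  then show ?case using pr by (intro exI[of _ "[:-s, 1:] * r' + [:c:]"]) (simp add: of_rat_minus del: mult_pCons_left)
qed

lemma bezout_irreducible:
  fixes p q :: "rat poly"
  assumes "irreducible p" "\<not> p dvd q"
  obtains a b where "a * p + b * q = 1"
proof -
  have "coprime p q"
    by (rule coprimeI) (use assms in \<open>meson dvd_trans irreducibleD'\<close>)
  then show ?thesis using that
    by (metis bezout_coefficients_fst_snd coprime_imp_gcd_eq_1)
qed

lemma irreducible_dvd_if_common_complex_root:
  fixes p q :: "rat poly"
  assumes "irreducible p" "poly (cpx p) z = 0" "poly (cpx q) z = 0"
  shows "p dvd q"
proof (rule ccontr)
  assume "\<not> p dvd q"
  then obtain a b where "a * p + b * q = 1" using bezout_irreducible[OF assms(1)] by blast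
  then have "cpx a * cpx p + cpx b * cpx q = 1" by (metis cpx_simps(1,3,5))
  then have "poly (cpx a * cpx p + cpx b * cpx q) z = 1" by simp
  then show False using assms by simp
qed

text \<open>
  Each root of \<open>q\<close> shows that the irreducible \<open>p\<close> divides \<open>q\<close>, so \<open>p\<close> can be split off repeatedly.
\<close>

lemma monic_power_of_irreducible:
  fixes p q :: "rat poly"
  assumes "irreducible p" "lead_coeff p = 1" "lead_coeff q = 1"
    and "\<And>z. poly (cpx q) z = 0 \<Longrightarrow> poly (cpx p) z = 0"
  shows "\<exists>k. q = p ^ k"
  using assms(3,4)
proof (induction "degree q" arbitrary: q rule: less_induct)
  case less
  show ?case
  proof (cases "degree q = 0")
    case True
    then have "q = 1" using less(2) by (auto elim!: degree_eq_zeroE)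
    then show ?thesis by (intro exI[of _ 0]) simp
  next
    case False
    then obtain z where z: "poly (cpx q) z = 0"
      by (metis degree_cpx constant_degree fundamental_theorem_of_algebra)
    then have "p dvd q"
      using irreducible_dvd_if_common_complex_root assms(1) less(3) by blast
    then obtain r where r: "q = p * r" by (elim dvdE)
    have p: "degree p > 0" using assms(1,2)
      by (metis irreducible_def is_unit_iff_degree not_gr_zero)
    have r0: "r \<noteq> 0" using r less(2) by auto
    have "lead_coeff r = 1" using less(2) assms(2) r by (simp add: lead_coeff_mult)
    moreover have "degree r < degree q" using r p r0 degree_mult_eq[of p r] by fastforce
    ultimately obtain k where "r = p ^ k" using less(1)[of r] less(3) r by auto
    then show ?thesis using r by (intro exI[of _ "Suc k"]) simp
  qed
qed

lemma monic_linear_prod_mset: "lead_coeff (\<Prod>y\<in>#A. [:- f y, 1::complex:]) = 1"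
  by (induction A) (auto simp: lead_coeff_mult simp del: mult_pCons_left)

lemma degree_linear_prod_mset: "degree (\<Prod>y\<in>#A. [:- f y, 1::complex:]) = size A"
proof (induction A)
  case (add x A)
  have "(\<Prod>y\<in>#A. [:- f y, 1::complex:]) \<noteq> 0"
    by (auto simp: prod_mset_zero_iff)
  with add show ?case by (simp add: degree_mult_eq del: mult_pCons_left)
qed simp

text \<open>
  The norm form of Capelli's theorem, by way of complex roots. The monic polynomial whose roots
  are the \<open>n\<close>-th powers of the roots of \<open>g\<close> is rational by \<open>prod_over_roots_in_Rats\<close> and
  \<open>rat_coeffs_if_rat_values\<close>, and all its roots are roots of \<open>h\<close>; hence it is a power \<open>h ^ k\<close>. Comparing
  degrees and constant terms gives the claim. In terms of a root \<open>\<alpha>\<close> of \<open>h\<close>, it says that the norm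
  of \<open>\<alpha>\<close> to the power \<open>k\<close> is an \<open>n\<close>-th power.
\<close>

lemma factor_of_power_substitution:
  fixes h g :: "rat poly"
  assumes "irreducible h" "lead_coeff h = 1" "lead_coeff g = 1" "n > 0"
    and "g dvd pcompose h (monom 1 n)"
  shows "\<exists>k. degree g = k * degree h \<and>
    ((-1) ^ degree h * coeff h 0) ^ k = ((-1) ^ degree g * coeff g 0) ^ n"
proof -
  let ?A = "proots (cpx g)"
  have g0: "g \<noteq> 0" using assms(3) by auto
  \<comment> \<open>the polynomial whose roots are the \<open>n\<close>-th powers of the roots of \<open>g\<close>\<close>
  define X :: "complex poly" where "X = (\<Prod>y\<in>#?A. [:-(y ^ n), 1:])"
  have "poly X (of_rat t) \<in> \<rat>" for t
  proof -
    have "poly X (of_rat t) = (\<Prod>y\<in>#?A. poly (cpx ([:t:] - monom 1 n)) y)"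
      by (simp add: X_def poly_prod_mset image_mset.compositionality o_def map_poly_monom poly_monom)
    then show ?thesis using prod_over_roots_in_Rats[OF assms(3)] by metis
  qed
  then obtain x where x: "X = cpx x"
    using rat_coeffs_if_rat_values[of UNIV X] infinite_UNIV_char_0 by auto
  have "lead_coeff X = 1"
    by (simp add: X_def monic_linear_prod_mset)
  then have "lead_coeff x = 1" by (simp add: x coeff_map_poly)
  moreover have "poly (cpx h) z = 0" if z: "poly (cpx x) z = 0" for z
  proof -
    have "poly X z = (\<Prod>y\<in>#?A. z - y ^ n)"
      by (simp add: X_def poly_prod_mset image_mset.compositionality o_def)
    then obtain y where y: "y \<in># ?A" "z = y ^ n" using z x by auto
    then have "poly (cpx g) y = 0" using g0 by simp
    then have "poly (cpx (pcompose h (monom 1 n))) y = 0"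
      using assms(5) by (metis cpx_simps(3) dvdE mult_zero_left poly_mult)
    then show ?thesis using y by (simp add: poly_pcompose map_poly_monom poly_monom)
  qed
  ultimately obtain k where k: "x = h ^ k"
    using monic_power_of_irreducible[OF assms(1,2), of x] by auto
  have "degree X = size ?A"
    by (simp add: X_def degree_linear_prod_mset)
  then have deg: "degree g = k * degree h"
    using k x assms(1) degree_power_eq[of h k] by (simp add: size_proots_complex irreducible_def flip: cpx_power)
  have sz: "size ?A = degree g" by (simp add: size_proots_complex)
  have const: "poly (cpx q) 0 = of_rat (coeff q 0)" for q
    by (simp add: poly_0_coeff_0 coeff_map_poly)
  have pm: "(\<Prod>y\<in>#A. - f y) = (-1) ^ size A * (\<Prod>y\<in>#A. f y)" for A :: "complex multiset" and f :: "complex \<Rightarrow> complex"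
    by (induction A) auto
  have pw: "(\<Prod>y\<in>#A. y ^ n) = (\<Prod>y\<in>#A. y) ^ n" for A :: "complex multiset"
    by (induction A) (auto simp: power_mult_distrib)
  have "of_rat (coeff g 0) = (-1) ^ degree g * (\<Prod>y\<in>#?A. y)"
    using poly_cpx_eq_prod[OF assms(3), of 0] pm[of "\<lambda>y. y" ?A] sz const by simp
  then have P: "(\<Prod>y\<in>#?A. y) = (-1) ^ degree g * of_rat (coeff g 0)"
    by (simp add: mult.assoc[symmetric] power_mult_distrib[symmetric])
  have "of_rat (coeff h 0 ^ k) = poly X 0"
    using const[of "h ^ k"] x k by (simp add: poly_0_coeff_0[symmetric])
  also have "\<dots> = (-1) ^ degree g * (\<Prod>y\<in>#?A. y) ^ n"
    by (simp add: X_def poly_prod_mset image_mset.compositionality o_def pm sz pw)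
  also have "\<dots> = of_rat ((-1) ^ degree g * ((-1) ^ degree g * coeff g 0) ^ n)"
    unfolding P by (simp add: of_rat_mult of_rat_power of_rat_minus)
  finally have "coeff h 0 ^ k = (-1) ^ degree g * ((-1) ^ degree g * coeff g 0) ^ n"
    using of_rat_eq_iff by blast
  moreover have "((-1) ^ degree h) ^ k = ((-1) ^ degree g :: rat)"
    by (simp add: deg power_mult[symmetric] mult.commute)
  ultimately have "((-1) ^ degree h * coeff h 0) ^ k = ((-1) ^ degree g * coeff g 0) ^ n"
    by (simp add: power_mult_distrib mult.assoc[symmetric])
  with deg show ?thesis by blast
qed

section \<open>Irreducibility of compositions with binomials\<close>

lemma rat_root_of_int:
  fixes x :: rat
  assumes "x ^ n = of_int z" "n > 0"
  shows "\<exists>y. x = of_int y"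
proof -
  obtain a b where q: "quotient_of x = (a, b)" by force
  have ab: "x = of_int a / of_int b" "b > 0" "coprime a b"
    using quotient_of_div[OF q] quotient_of_denom_pos[OF q] quotient_of_coprime[OF q] by auto
  have "of_int a ^ n = (of_int z * of_int b ^ n :: rat)"
    using assms(1) ab by (simp add: field_simps)
  then have "a ^ n = z * b ^ n" by (metis of_int_eq_iff of_int_mult of_int_power)
  then have "b ^ n dvd a ^ n" by simp
  moreover have "coprime (a ^ n) (b ^ n)" using ab(3) by simp
  ultimately have "is_unit (b ^ n)" by (metis coprime_absorb_right)
  then have "b = 1" using ab(2) assms(2) one_less_power[of b n] by (cases "1 < b") auto
  then show ?thesis using ab by auto
qed

text \<open>
  With \<open>k * u = p * v + 1\<close>, the number \<open>a\<close> is the \<open>p\<close>-th power of \<open>N ^ u / a ^ v\<close>.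
\<close>

lemma nth_power_if_coprime_power:
  fixes a N :: rat
  assumes "a ^ k = N ^ p" "coprime k p" "k > 0" "p > 0"
  shows "\<exists>r. a = r ^ p"
proof (cases "a = 0")
  case True
  then show ?thesis using assms(4) by (intro exI[of _ 0]) auto
next
  case False
  obtain u v where uv: "k * u = p * v + 1"
    using coprime_bezout_strong assms(2,3) bezout_nat[of k p] by (metis coprime_imp_gcd_eq_1 gr_implies_not0)
  have "a * (a ^ v) ^ p = a ^ (k * u)" by (simp add: uv power_mult[symmetric] mult.commute)
  also have "\<dots> = (N ^ u) ^ p" by (metis assms(1) mult.commute power_mult)
  finally have "a = (N ^ u / a ^ v) ^ p" using False by (simp add: power_divide field_simps)
  then show ?thesis by blast
qed

lemma monic_factor_if_reducible:
  fixes f :: "rat poly"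
  assumes "\<not> irreducible f" "degree f > 0"
  obtains g where "lead_coeff g = 1" "g dvd f" "0 < degree g" "degree g < degree f"
proof -
  have f: "f \<noteq> 0" using assms(2) by auto
  then have "\<not> is_unit f" using assms(2) by (simp add: is_unit_iff_degree)
  then obtain a b where ab: "f = a * b" "\<not> is_unit a" "\<not> is_unit b"
    using assms(1) f by (auto simp: irreducible_def)
  then have nz: "a \<noteq> 0" "b \<noteq> 0" using f by auto
  then have deg: "degree a > 0" "degree b > 0" "degree f = degree a + degree b"
    using ab by (auto simp: is_unit_iff_degree degree_mult_eq)
  show ?thesis
    by (rule that[of "smult (inverse (lead_coeff a)) a"]) (use nz ab(1) deg in \<open>auto simp: smult_dvd_iff\<close>)
qed

lemma pcompose_monom: "pcompose (monom c n) q = smult c (q ^ n)"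
  by (induction n) (simp_all add: monom_Suc pcompose_pCons monom_0)

lemma degree_pcompose_monom [simp]: "degree (pcompose h (monom 1 n)) = degree h * n"
  for h :: "rat poly"
  by (simp add: degree_pcompose degree_monom_eq)

lemma monic_pcompose:
  fixes f g :: "rat poly"
  assumes "lead_coeff f = 1" "lead_coeff g = 1" "degree g > 0"
  shows "lead_coeff (pcompose f g) = 1"
  using assms by (subst lead_coeff_comp) auto

text \<open>
  A proper factor of \<open>h(x ^ p)\<close> has degree \<open>k * degree h\<close> with \<open>0 < k < p\<close>. So the norm of a root
  of \<open>h\<close>, raised to a power prime to \<open>p\<close>, is a \<open>p\<close>-th power, and then so is the norm.
\<close>

lemma irreducible_power_substitution:
  fixes h :: "rat poly"
  assumes h: "irreducible h" "lead_coeff h = 1" and p: "prime p"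
    and np: "\<And>r. (-1) ^ degree h * coeff h 0 \<noteq> r ^ p"
  shows "irreducible (pcompose h (monom 1 p))"
proof (rule ccontr)
  assume red: "\<not> irreducible (pcompose h (monom 1 p))"
  have dh: "degree h > 0" using h by (metis irreducible_def is_unit_iff_degree not_gr_zero)
  have p0: "p > 0" using p prime_gt_0_nat by blast
  obtain g where g: "lead_coeff g = 1" "g dvd pcompose h (monom 1 p)" "0 < degree g" "degree g < degree h * p"
    using monic_factor_if_reducible[OF red] dh p0 by auto
  obtain k where k: "degree g = k * degree h"
    "((-1) ^ degree h * coeff h 0) ^ k = ((-1) ^ degree g * coeff g 0) ^ p"
    using factor_of_power_substitution[OF h g(1) p0 g(2)] by blast
  have "0 < k" "k < p" using k(1) g(3,4) dh by (auto simp: mult.commute)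
  then have "coprime k p" using p
    by (metis coprime_commute nat_dvd_not_less prime_imp_coprime)
  then show False using nth_power_if_coprime_power[OF k(2)] \<open>0 < k\<close> p0 np by blast
qed

lemma irreducible_translate:
  fixes f :: "rat poly"
  assumes "irreducible f" shows "irreducible (pcompose f [:c, 1:])"
proof -
  have inv: "pcompose (pcompose q [:c, 1:]) [:-c, 1:] = q" "pcompose (pcompose q [:-c, 1:]) [:c, 1:] = q" for q :: "rat poly"
    by (simp_all add: pcompose_assoc[symmetric] pcompose_pCons)
  have unit: "is_unit (pcompose q [:c, 1:]) \<longleftrightarrow> is_unit q" for q :: "rat poly"
    by (cases "q = 0") (auto simp: is_unit_iff_degree degree_pcompose pcompose_eq_0_iff)
  show ?thesis
  proof (rule irreducibleI)
    show "pcompose f [:c, 1:] \<noteq> 0" using assms inv(1)[of f] by auto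
    show "\<not> is_unit (pcompose f [:c, 1:])" using assms unit by (auto simp: irreducible_def)
    fix a b assume "pcompose f [:c, 1:] = a * b"
    then have "f = pcompose a [:-c, 1:] * pcompose b [:-c, 1:]"
      by (metis inv(1) pcompose_mult)
    then have "is_unit (pcompose a [:-c, 1:]) \<or> is_unit (pcompose b [:-c, 1:])"
      using assms irreducibleD by blast
    then show "is_unit a \<or> is_unit b" using unit inv(2) by metis
  qed
qed

text \<open>
  The substitution of \<open>x ^ d\<close> is made one prime at a time. It never changes the constant term, so
  the same integer \<open>z\<close> decides about every stage, and the case of \<open>4\<close> dividing \<open>d\<close> in Capelli's
  theorem needs no special treatment.
\<close>

lemma irreducible_pcompose_binomial:
  fixes f :: "rat poly" and z c :: int
  assumes f: "irreducible f" "lead_coeff f = 1" and d: "d > 0"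
    and even: "even d \<Longrightarrow> even (degree f)"
    and z: "poly f (of_int c) = of_int z"
    and np: "\<And>p y. prime p \<Longrightarrow> p dvd d \<Longrightarrow> z \<noteq> y ^ p"
  shows "irreducible (pcompose f (monom 1 d + [:of_int c:]))"
proof -
  define h where "h = pcompose f [:of_int c, 1:]"
  have h: "irreducible h" "lead_coeff h = 1" "coeff h 0 = of_int z" "degree h = degree f"
    using f z monic_pcompose[of f "[:of_int c, 1:]"]
    by (auto simp: h_def irreducible_translate degree_pcompose)
  have "irreducible (pcompose h (monom 1 e))" if "e dvd d" for e
    using that
  proof (induction e rule: less_induct)
    case (less e)
    have e: "e > 0" using less d by (metis dvd_pos_nat)
    show ?case
    proof (cases "e = 1")
      case True
      then show ?thesis using h by (simp add: monom_altdef)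
    next
      case False
      then obtain p where p: "prime p" "p dvd e" using prime_factor_nat by blast
      then obtain k where k: "e = k * p" by (metis dvd_def mult.commute)
      have "k < e" using k e prime_gt_1_nat[OF p(1)] by auto
      define g where "g = pcompose h (monom 1 k)"
      have k0: "k > 0" using k e by auto
      have g: "irreducible g"
        unfolding g_def using less(1)[OF \<open>k < e\<close>] less(2) k by (auto dest: dvd_mult_left)
      have g': "lead_coeff g = 1" "coeff g 0 = of_int z" "degree g = degree f * k"
        using monic_pcompose[OF h(2), of "monom 1 k"] k0 h(3,4)
        by (auto simp: g_def degree_monom_eq poly_0_coeff_0)
      have "irreducible (pcompose g (monom 1 p))"
      proof (rule irreducible_power_substitution[OF g g'(1) p(1)])
        fix r
        show "(-1) ^ degree g * coeff g 0 \<noteq> r ^ p"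
        proof
          assume r: "(-1) ^ degree g * coeff g 0 = r ^ p"
          have p0: "p > 0" using p(1) prime_gt_0_nat by blast
          have "r ^ p = of_int ((-1) ^ degree g * z)" using r g' by simp
          then obtain y where "r = of_int y" using rat_root_of_int p0 by blast
          then have "of_int ((-1) ^ degree g * z) = (of_int (y ^ p) :: rat)" using r g' by simp
          then have y: "(-1) ^ degree g * z = y ^ p" by (simp only: of_int_eq_iff)
          have pd: "p dvd d" using p(2) less(2) by (rule dvd_trans)
          show False
          proof (cases "even (degree g)")
            case True
            then show ?thesis using y np[OF p(1) pd] by auto
          next
            case False
            then have "odd p" using even g'(3) pd by (auto intro: dvd_trans)
            then have "z = (- y) ^ p" using y False by (simp add: power_minus_odd)
            then show ?thesis using np[OF p(1) pd] by blast
          qed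
        qed
      qed
      moreover have "pcompose g (monom 1 p) = pcompose h (monom 1 e)"
      proof -
        have "pcompose (monom 1 k) (monom 1 p) = monom (1::rat) e"
          by (simp add: pcompose_monom monom_power k mult.commute)
        then show ?thesis by (simp add: g_def pcompose_assoc[symmetric])
      qed
      ultimately show ?thesis by simp
    qed
  qed
  then have "irreducible (pcompose h (monom 1 d))" by simp
  then show ?thesis by (simp add: h_def pcompose_assoc[symmetric] pcompose_pCons add.commute)
qed

section \<open>Words in the generators\<close>

definition binomial_poly :: "nat \<Rightarrow> int \<Rightarrow> rat poly" where
  "binomial_poly d c = monom 1 d + [:of_int c:]"

primrec word_poly :: "nat \<Rightarrow> int list \<Rightarrow> rat poly" where
  "word_poly d [] = [:0, 1:]"
| "word_poly d (c # w) = pcompose (binomial_poly d c) (word_poly d w)"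

primrec word_value :: "nat \<Rightarrow> int list \<Rightarrow> int \<Rightarrow> int" where
  "word_value d [] x = x"
| "word_value d (c # w) x = word_value d w x ^ d + c"

text \<open>
  By the norm criterion, appending a letter at whose constant the preceding word has the value \<open>t\<close>
  preserves irreducibility of a composition with outermost letter \<open>a\<close>.
\<close>

definition avoids_powers :: "nat \<Rightarrow> int \<Rightarrow> int \<Rightarrow> bool" where
  "avoids_powers d a t \<longleftrightarrow> (\<forall>p y. prime p \<longrightarrow> p dvd d \<longrightarrow> t ^ d + a \<noteq> y ^ p)"

lemma degree_binomial_poly [simp]: "d > 0 \<Longrightarrow> degree (binomial_poly d c) = d"
  unfolding binomial_poly_def by (subst degree_add_eq_left) (auto simp: degree_monom_eq)

lemma monic_binomial_poly: "d > 0 \<Longrightarrow> lead_coeff (binomial_poly d c) = 1"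
  by (simp, simp add: binomial_poly_def coeff_pCons split: nat.splits)

lemma word_poly_append: "word_poly d (u @ w) = pcompose (word_poly d u) (word_poly d w)"
  by (induction u) (auto simp: pcompose_assoc pcompose_pCons)

lemma word_value_append: "word_value d (u @ w) x = word_value d u (word_value d w x)"
  by (induction u) auto

lemma degree_word_poly [simp]: "d > 0 \<Longrightarrow> degree (word_poly d w) = d ^ length w"
  by (induction w) (auto simp: degree_pcompose)

lemma monic_word_poly: "d > 0 \<Longrightarrow> lead_coeff (word_poly d w) = 1"
proof (induction w)
  case (Cons c w)
  then have "degree (word_poly d w) > 0" by simp
  with Cons show ?case
    unfolding word_poly.simps by (intro monic_pcompose monic_binomial_poly) auto
qed simp

lemma poly_word_poly: "poly (word_poly d w) (of_int x) = of_int (word_value d w x)"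
  by (induction w) (auto simp: poly_pcompose binomial_poly_def poly_monom)

lemma irreducible_word_append_letter:
  assumes "d > 0" "irreducible (word_poly d (a # u))" "avoids_powers d a (word_value d u c)"
  shows "irreducible (word_poly d (a # u @ [c]))"
proof -
  have "irreducible (pcompose (word_poly d (a # u)) (monom 1 d + [:of_int c:]))"
  proof (rule irreducible_pcompose_binomial)
    show "poly (word_poly d (a # u)) (of_int c) = of_int (word_value d (a # u) c)"
      by (rule poly_word_poly)
    show "word_value d (a # u) c \<noteq> y ^ p" if "prime p" "p dvd d" for p y
      using assms(3) that by (auto simp: avoids_powers_def)
    show "even d \<Longrightarrow> even (degree (word_poly d (a # u)))"
      unfolding degree_word_poly[OF assms(1)] by simp
    show "lead_coeff (word_poly d (a # u)) = 1" using monic_word_poly[OF assms(1)] .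
  qed (use assms in auto)
  moreover have "word_poly d (a # u @ [c]) = pcompose (word_poly d (a # u)) (monom 1 d + [:of_int c:])"
    using word_poly_append[of d "a # u" "[c]"] by (simp add: binomial_poly_def)
  ultimately show ?thesis by metis
qed

lemma irreducible_word_append:
  assumes "d > 0" "irreducible (word_poly d (a # u))"
    and "\<And>x c y. w = x @ c # y \<Longrightarrow> avoids_powers d a (word_value d u (word_value d x c))"
  shows "irreducible (word_poly d (a # u @ w))"
  using assms(3)
proof (induction w rule: rev_induct)
  case Nil
  then show ?case using assms(2) by simp
next
  case (snoc c w)
  have "irreducible (word_poly d (a # u @ w))"
    by (rule snoc.IH, rule snoc.prems) auto
  moreover have "avoids_powers d a (word_value d (u @ w) c)"
    using snoc.prems[of w c "[]"] by (simp add: word_value_append)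
  ultimately show ?case
    using irreducible_word_append_letter[OF assms(1), of a "u @ w" c] by simp
qed

lemma irreducible_if_irreducible_pcompose:
  fixes f g :: "rat poly"
  assumes "irreducible (pcompose f g)" "degree g > 0"
  shows "irreducible f"
proof (rule irreducibleI)
  show f0: "f \<noteq> 0" using assms by auto
  have unit: "is_unit q" if "is_unit (pcompose q g)" for q
  proof -
    have "pcompose q g \<noteq> 0" using that by auto
    then have "degree q = 0" "q \<noteq> 0" using that assms(2) by (auto simp: is_unit_iff_degree degree_pcompose)
    then show ?thesis by (simp add: is_unit_iff_degree)
  qed
  show "\<not> is_unit f"
  proof
    assume "is_unit f"
    then obtain c where c: "f = [:c:]" by (auto elim: is_unit_polyE)
    with f0 have "c \<noteq> 0" by auto
    with c have "is_unit (pcompose f g)" by (simp add: is_unit_iff_degree)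
    then show False using assms(1) by (auto simp: irreducible_def)
  qed
  fix a b assume "f = a * b"
  then have "pcompose f g = pcompose a g * pcompose b g" by (simp add: pcompose_mult)
  then show "is_unit a \<or> is_unit b" using assms(1) unit irreducibleD by blast
qed

lemma irreducible_first_letter:
  assumes "d > 0" "irreducible (word_poly d (a # w))" shows "irreducible (binomial_poly d a)"
  using irreducible_if_irreducible_pcompose[of "binomial_poly d a" "word_poly d w"] assms by simp

section \<open>Gaps between powers and integer orbits of binomials\<close>

lemma power_gap:
  fixes x y :: int
  assumes "0 \<le> y" "y < x"
  shows "x ^ (n + 1) + y ^ (n + 1) \<le> x ^ (n + 2) - y ^ (n + 2)"
proof (induction n)
  case 0
  have "1 * (x + y) \<le> (x - y) * (x + y)" using assms by (intro mult_right_mono) auto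
  then show ?case by (simp add: power2_eq_square algebra_simps)
next
  case (Suc n)
  have "x * (x ^ (n + 1) + y ^ (n + 1)) \<le> x * (x ^ (n + 2) - y ^ (n + 2))"
    using Suc assms by (intro mult_left_mono) auto
  moreover have "1 * y ^ (n + 2) \<le> (x - y) * y ^ (n + 2)" using assms by (intro mult_right_mono) auto
  moreover have "0 \<le> x * y ^ (n + 1)" using assms by auto
  ultimately show ?case by (simp add: algebra_simps)
qed

lemma power_gap':
  fixes x y :: int
  assumes "0 \<le> y" "y < x" "d \<ge> 2"
  shows "x ^ (d - 1) + y ^ (d - 1) \<le> x ^ d - y ^ d"
proof -
  obtain n where "d = n + 2" using assms(3) by (metis add.commute le_Suc_ex)
  then show ?thesis using power_gap[OF assms(1,2), of n] by simp
qed

lemma power_mono_exp_int: "0 \<le> (x::int) \<Longrightarrow> 0 < m \<Longrightarrow> m \<le> n \<Longrightarrow> x ^ m \<le> x ^ n"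
  by (cases "x = 0") (auto simp: power_increasing power_0_left)

lemma between_consecutive_powers:
  fixes u y :: int
  assumes "0 \<le> u" "u ^ p < z" "z < (u + 1) ^ p"
  shows "z \<noteq> y ^ p"
proof
  assume z: "z = y ^ p"
  have "\<bar>y\<bar> ^ p = z" using z assms by (metis power_abs abs_of_nonneg le_less_trans less_imp_le zero_le_power)
  then have "u < \<bar>y\<bar>" "\<bar>y\<bar> < u + 1"
    using assms power_less_imp_less_base[of u p "\<bar>y\<bar>"] power_less_imp_less_base[of "\<bar>y\<bar>" p "u + 1"] by auto
  then show False by auto
qed

text \<open>
  The two powers of neighbouring bases that enclose \<open>u ^ p\<close> are further than \<open>\<bar>u\<bar>\<close> away from it,
  so \<open>u ^ p + a\<close> would have to be \<open>u ^ p\<close> or \<open>- u ^ p\<close>.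
\<close>

lemma power_plus_ne_power:
  fixes u a y :: int
  assumes "\<bar>a\<bar> \<le> \<bar>u\<bar>" "2 \<le> \<bar>a\<bar>" "2 \<le> p"
  shows "u ^ p + a \<noteq> y ^ p"
proof
  assume eq: "u ^ p + a = y ^ p"
  define U where "U = \<bar>u\<bar>"
  define Y where "Y = \<bar>y\<bar>"
  have U: "2 \<le> U" "\<bar>a\<bar> \<le> U" using assms by (auto simp: U_def)
  have up: "\<bar>u ^ p\<bar> = U ^ p" "\<bar>y ^ p\<bar> = Y ^ p" by (auto simp: U_def Y_def power_abs)
  have g1: "U ^ (p - 1) + (U - 1) ^ (p - 1) \<le> U ^ p - (U - 1) ^ p"
    and g2: "(U + 1) ^ (p - 1) + U ^ (p - 1) \<le> (U + 1) ^ p - U ^ p"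
    using power_gap'[of "U - 1" U p] power_gap'[of U "U + 1" p] U assms(3) by auto
  have e: "U \<le> U ^ (p - 1)" "1 \<le> (U - 1) ^ (p - 1)" "1 \<le> (U + 1) ^ (p - 1)" "U \<le> U ^ p"
    using U assms(3) by (auto intro!: self_le_power one_le_power)
  have "U ^ p - \<bar>a\<bar> \<le> Y ^ p" "Y ^ p \<le> U ^ p + \<bar>a\<bar>" using eq up by auto
  then have "(U - 1) ^ p < Y ^ p" "Y ^ p < (U + 1) ^ p" using g1 g2 e U by linarith+
  then have "U - 1 < Y" "Y < U + 1"
    using U power_less_imp_less_base[of "U - 1" p Y] power_less_imp_less_base[of Y p "U + 1"]
    by (auto simp: Y_def)
  then have "Y = U" by simp
  then have "Y ^ p = U ^ p" by simp
  then show False using eq up e U assms(2) by linarith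
qed

lemma prime_dvd_cofactor:
  assumes "prime p" "p dvd (d::nat)" "d > 0"
  obtains k where "d = k * p" "k > 0" "p \<ge> 2"
  using assms by (metis dvdE gr0I mult.commute mult_0_right prime_ge_2_nat)

lemma avoids_powers_large:
  assumes "d > 0" "2 \<le> \<bar>a\<bar>" "\<bar>a\<bar> \<le> \<bar>t\<bar>"
  shows "avoids_powers d a t"
  unfolding avoids_powers_def
proof (intro allI impI)
  fix p y assume "prime p" "p dvd d"
  then obtain k where k: "d = k * p" "k > 0" "p \<ge> 2" using prime_dvd_cofactor assms(1) by blast
  have "\<bar>t\<bar> \<le> \<bar>t\<bar> ^ k" using k assms by (intro self_le_power) auto
  then have "\<bar>a\<bar> \<le> \<bar>t ^ k\<bar>" using assms by (simp add: power_abs)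
  then show "t ^ d + a \<noteq> y ^ p" using power_plus_ne_power assms k by (auto simp: power_mult)
qed

text \<open>
  For positive \<open>a\<close> this also covers \<open>a = 1\<close>, where the bound on \<open>\<bar>a\<bar>\<close> in the previous lemma fails.
\<close>

lemma avoids_powers_positive:
  assumes "d > 0" "0 < a" "a \<le> t"
  shows "avoids_powers d a t"
  unfolding avoids_powers_def
proof (intro allI impI)
  fix p y assume "prime p" "p dvd d"
  then obtain k where k: "d = k * p" "k > 0" "p \<ge> 2" using prime_dvd_cofactor assms(1) by blast
  have "t \<le> t ^ k" using k assms by (intro self_le_power) auto
  then have u: "a \<le> t ^ k" using assms by simp
  have "(t ^ k + 1) ^ (p - 1) + (t ^ k) ^ (p - 1) \<le> (t ^ k + 1) ^ p - (t ^ k) ^ p"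
    using power_gap'[of "t ^ k" "t ^ k + 1" p] u assms k by auto
  moreover have "t ^ k + 1 \<le> (t ^ k + 1) ^ (p - 1)" "0 \<le> (t ^ k) ^ (p - 1)"
    using u assms k by (auto intro!: self_le_power)
  ultimately have "(t ^ k) ^ p + a < (t ^ k + 1) ^ p" using u by linarith
  then show "t ^ d + a \<noteq> y ^ p"
    using between_consecutive_powers[of "t ^ k" p "t ^ d + a" y] u assms k by (simp add: power_mult)
qed

lemma abs_orbit_mono:
  fixes k x :: int
  assumes "d \<ge> 2" "2 \<le> \<bar>k\<bar>" "\<bar>k\<bar> \<le> \<bar>x\<bar>"
  shows "\<bar>k\<bar> \<le> \<bar>x ^ d + k\<bar>"
proof -
  have "\<bar>x\<bar> ^ 2 \<le> \<bar>x\<bar> ^ d" using assms by (intro power_increasing) auto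
  moreover have "2 * \<bar>x\<bar> \<le> \<bar>x\<bar> ^ 2" using assms unfolding power2_eq_square by (intro mult_right_mono) auto
  moreover have "\<bar>x ^ d\<bar> = \<bar>x\<bar> ^ d" by (rule power_abs)
  ultimately show ?thesis using assms by linarith
qed

text \<open>
  Read the orbit backwards: \<open>n1\<close>, \<open>n2\<close> and \<open>n3\<close> are \<open>d\<close>-th roots of numbers that differ from \<open>- k\<close>
  by the small amounts \<open>t\<close>, \<open>n1\<close> and \<open>n2\<close>. Already \<open>\<bar>n2\<bar>\<close> and \<open>\<bar>n3\<bar>\<close> must coincide, because distinct
  \<open>d\<close>-th powers of that size differ by more than \<open>\<bar>n1\<bar> + \<bar>n2\<bar>\<close>. The signs then leave only a fixed
  point.
\<close>

lemma small_third_iterate_is_fixed: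
  fixes k t n1 n2 n3 :: int
  assumes d: "d \<ge> 3" and k: "2 \<le> \<bar>k\<bar>"
    and n2: "n2 = n3 ^ d + k" and n1: "n1 = n2 ^ d + k" and t: "t = n1 ^ d + k" and small: "\<bar>t\<bar> < \<bar>k\<bar>"
  shows "k = t - t ^ d \<and> (n3 = t \<or> (even d \<and> n3 = - t))"
proof -
  define a1 a2 a3 K where "a1 = \<bar>n1\<bar>" "a2 = \<bar>n2\<bar>" "a3 = \<bar>n3\<bar>" "K = \<bar>k\<bar>"
  note defs = this
  have nn: "a1 \<ge> 0" "a2 \<ge> 0" "a3 \<ge> 0" "K \<ge> 2" using k by (auto simp: defs)
  have pa: "\<bar>n1 ^ d\<bar> = a1 ^ d" "\<bar>n2 ^ d\<bar> = a2 ^ d" "\<bar>n3 ^ d\<bar> = a3 ^ d" by (auto simp: defs power_abs)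
  have h1: "a1 ^ d < 2 * K" using pa t small unfolding defs by linarith
  have h2: "K - a1 \<le> a2 ^ d" "a2 ^ d \<le> K + a1" using pa n1 unfolding defs by linarith+
  have h3: "\<bar>a2 ^ d - a3 ^ d\<bar> \<le> a1 + a2" using pa n1 n2 unfolding defs by linarith
  have cube: "x ^ 3 \<le> x ^ d" if "x \<ge> 0" for x :: int using d that by (intro power_mono_exp_int) auto
  have sq: "x ^ 2 \<le> x ^ (d - 1)" if "x \<ge> 0" for x :: int using d that by (intro power_mono_exp_int) auto
  have a2: "a2 \<ge> 1"
  proof (rule ccontr)
    assume "\<not> a2 \<ge> 1"
    then have "n2 = 0" by (auto simp: defs)
    then have "a1 = K" using n1 d by (simp add: defs power_0_left)
    moreover have "K * 2 \<le> K * K" using nn by (intro mult_left_mono) auto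
    moreover have "K ^ 2 \<le> K ^ d" using d nn by (intro power_mono_exp_int) auto
    ultimately show False using h1 by (simp add: power2_eq_square)
  qed
  have a12: "a1 \<le> 2 * a2 - 1"
  proof (rule ccontr)
    assume "\<not> a1 \<le> 2 * a2 - 1"
    then have ge: "2 * a2 \<le> a1" by simp
    have "(2 * a2) ^ d \<le> a1 ^ d" using ge nn by (intro power_mono) auto
    moreover have "2 ^ 3 * a2 ^ d \<le> 2 ^ d * a2 ^ d" using nn d by (intro mult_right_mono power_increasing) auto
    ultimately have "8 * a2 ^ d \<le> a1 ^ d" by (simp add: power_mult_distrib)
    moreover have "4 * a1 \<le> a1 ^ 3"
    proof -
      have "2 * 2 * a1 \<le> a1 * a1 * a1" using ge a2 by (intro mult_mono) auto
      then show ?thesis by (simp add: power3_eq_cube)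
    qed
    then have "4 * a1 \<le> a1 ^ d" using cube[of a1] nn by linarith
    ultimately show False using h1 h2 nn a2 ge by linarith
  qed
  have eq: "a2 = a3"
  proof (rule ccontr)
    assume ne: "a2 \<noteq> a3"
    have "a2 ^ (d - 1) + a3 ^ (d - 1) \<le> \<bar>a2 ^ d - a3 ^ d\<bar>"
      using power_gap'[of a2 a3 d] power_gap'[of a3 a2 d] nn d ne by (cases "a2 < a3") auto
    then have s: "a2 ^ 2 + a3 ^ 2 \<le> 3 * a2 - 1" using sq[of a2] sq[of a3] nn h3 a12 by linarith
    have "a2 < 3"
    proof (rule ccontr)
      assume "\<not> a2 < 3"
      then have "3 * a2 \<le> a2 * a2" by (intro mult_right_mono) auto
      moreover have "0 \<le> a3 * a3" by simp
      ultimately show False using s unfolding power2_eq_square by linarith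
    qed
    have a3lt: "a3 < 2"
    proof (rule ccontr)
      assume "\<not> a3 < 2"
      then have "2 * 2 \<le> a3 * a3" by (intro mult_mono) auto
      moreover have "a2 = 1 \<or> a2 = 2" using \<open>a2 < 3\<close> a2 by linarith
      ultimately show False using s by (auto simp: power2_eq_square)
    qed
    have z: "n3 = 0 \<Longrightarrow> a2 = K" using n2 d by (simp add: defs power_0_left)
    consider "a2 = 1" "a3 = 0" | "a2 = 2" "a3 = 0" | "a2 = 2" "a3 = 1"
      using ne nn a2 \<open>a2 < 3\<close> a3lt by linarith
    then show False
    proof cases
      case 1
      then show ?thesis using z nn by (auto simp: defs)
    next
      case 2
      then have "K = 2" using z by (auto simp: defs)
      then show ?thesis using cube[of 2] h2 a12 2 by simp
    next
      case 3
      have "K \<le> a2 + a3 ^ d" using n2 pa unfolding defs by linarith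
      then show ?thesis using cube[of 2] h2 a12 3 by simp
    qed
  qed
  \<comment> \<open>odd \<open>d\<close> with \<open>n3 = - n2\<close> would force \<open>n1 + n2 = 2 * k\<close>, which is too large\<close>
  have even_odd: "n1 = n2 \<and> (n3 = n2 \<or> (even d \<and> n3 = - n2))"
  proof (cases "n3 = n2")
    case True
    then show ?thesis using n1 n2 by simp
  next
    case False
    then have m: "n3 = - n2" using eq by (auto simp: defs)
    show ?thesis
    proof (cases "even d")
      case True
      then have "n3 ^ d = n2 ^ d" using m by simp
      then have "n1 = n2" using n1 n2 by linarith
      then show ?thesis using m True by blast
    next
      case odd: False
      then have "n3 ^ d = - (n2 ^ d)" using m by (simp add: power_minus_odd)
      then have "n1 + n2 = 2 * k" "n2 ^ d = k - n2" using n1 n2 by linarith+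
      then have b: "2 * K \<le> a1 + a2" "a2 ^ d \<le> K + a2" using pa unfolding defs by linarith+
      then have "2 * a2 ^ 3 \<le> 5 * a2 - 1" using a12 cube[of a2] nn by linarith
      moreover have "a2 \<ge> 2" using b(1) a12 nn by linarith
      then have "2 * 2 * a2 \<le> a2 * a2 * a2" by (intro mult_mono) auto
      ultimately show ?thesis using a2 by (simp add: power3_eq_cube)
    qed
  qed
  then have "t = n1" using t n1 by simp
  then show ?thesis using even_odd t by auto
qed

text \<open>
  The same comparison as for higher degree, but distinct squares are closer together: \<open>\<bar>n2\<bar>\<close> and
  \<open>\<bar>n3\<bar>\<close> may also differ by one. This is what happens on the cycle that exchanges \<open>t\<close> and \<open>- 1 - t\<close>.
\<close>

lemma small_third_iterate_quadratic:
  fixes C t n1 n2 n3 :: int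
  assumes C: "2 \<le> C" and n2: "n2 = n3\<^sup>2 - C" and n1: "n1 = n2\<^sup>2 - C" and t: "t = n1\<^sup>2 - C" and small: "\<bar>t\<bar> < C"
  shows "(C = t\<^sup>2 - t \<and> n3\<^sup>2 = t\<^sup>2) \<or> (C = t\<^sup>2 + t + 1 \<and> n3\<^sup>2 = (t + 1)\<^sup>2)"
proof -
  define a1 a2 a3 where "a1 = \<bar>n1\<bar>" "a2 = \<bar>n2\<bar>" "a3 = \<bar>n3\<bar>"
  note defs = this
  have nn: "a1 \<ge> 0" "a2 \<ge> 0" "a3 \<ge> 0" by (auto simp: defs)
  have pa: "n1\<^sup>2 = a1\<^sup>2" "n2\<^sup>2 = a2\<^sup>2" "n3\<^sup>2 = a3\<^sup>2" by (auto simp: defs)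
  have d32: "a3\<^sup>2 - a2\<^sup>2 = n2 - n1" using n1 n2 pa by linarith
  have h: "(a1 - 1)\<^sup>2 \<le> 2 * a2\<^sup>2"
  proof -
    have "a1\<^sup>2 \<le> 2 * C - 1" using t small pa by linarith
    moreover have "C \<le> a2\<^sup>2 + a1" using n1 pa unfolding defs by linarith
    ultimately show ?thesis by (simp add: power2_eq_square algebra_simps)
  qed
  have a12: "2 * a1 \<le> 3 * a2 + 2"
  proof (rule ccontr)
    assume "\<not> ?thesis"
    then have "3 * a2 < 2 * (a1 - 1)" by simp
    then have "(3 * a2) ^ 2 < (2 * (a1 - 1)) ^ 2" using nn by (intro power_strict_mono) auto
    then have "9 * a2\<^sup>2 < 4 * (a1 - 1)\<^sup>2" by (simp add: power2_eq_square algebra_simps)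
    moreover have "0 \<le> a2\<^sup>2" by simp
    ultimately show False using h by linarith
  qed
  have ds: "\<bar>a3\<^sup>2 - a2\<^sup>2\<bar> \<le> a1 + a2" using d32 unfolding defs by linarith
  consider "a3 \<ge> a2 + 2" | "a3 = a2 + 1" | "a3 = a2" | "a3 = a2 - 1" | "a3 \<le> a2 - 2" by linarith
  then show ?thesis
  proof cases
    case 1
    then have "(a2 + 2)\<^sup>2 \<le> a3\<^sup>2" using nn by (intro power_mono) auto
    then have "4 * a2 + 4 \<le> a1 + a2" using ds by (simp add: power2_eq_square algebra_simps)
    then show ?thesis using a12 nn by linarith
  next
    case 2
    then have e: "2 * a2 + 1 = n2 - n1" using d32 by (simp add: power2_eq_square algebra_simps)
    show ?thesis
    proof (cases "n2 = a2")
      case True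
      then have n1': "n1 = - a2 - 1" using e by simp
      then have "C = a2\<^sup>2 + a2 + 1" using n1 pa by simp
      moreover have "t = a2" using t n1' calculation by (simp add: power2_eq_square algebra_simps)
      ultimately show ?thesis using 2 pa by simp
    next
      case False
      then have n2': "n2 = - a2" "a2 > 0" by (auto simp: defs)
      then have "a1 = 3 * a2 + 1" using e by (simp add: defs)
      then show ?thesis using a12 n2' by simp
    qed
  next
    case 3
    then have "n1 = n2" using d32 by simp
    then have "t = n1" using t n1 by simp
    then show ?thesis using t 3 pa \<open>n1 = n2\<close> by simp
  next
    case 4
    then have "(a2 - 1)\<^sup>2 - a2\<^sup>2 = n2 - n1" using d32 by simp
    then have e: "1 - 2 * a2 = n2 - n1" by (simp add: power2_eq_square algebra_simps)
    show ?thesis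
    proof (cases "n2 = a2")
      case True
      then have n1': "n1 = 3 * a2 - 1" using e by simp
      then have "a2 = 1" using a12 4 nn by (simp add: defs)
      then show ?thesis using n2 C True 4 pa by simp
    next
      case False
      then have n2': "n2 = - a2" by (auto simp: defs)
      then have n1': "n1 = a2 - 1" using e by simp
      then have C': "C = a2\<^sup>2 - a2 + 1" using n1 pa by simp
      then have t': "t = - a2" using t n1' by (simp add: power2_eq_square algebra_simps)
      have "n3\<^sup>2 = (a2 - 1)\<^sup>2" using 4 pa by simp
      then show ?thesis unfolding t' C' by (simp add: power2_eq_square algebra_simps)
    qed
  next
    case 5
    then have "a3\<^sup>2 \<le> (a2 - 2)\<^sup>2" using nn by (intro power_mono) auto
    then have "4 * a2 - 4 \<le> a1 + a2" using ds by (simp add: power2_eq_square algebra_simps)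
    then have "a2 \<le> 3" using a12 by linarith
    then consider "a2 = 2" "a3 = 0" | "a2 = 3" "a3 = 0" | "a2 = 3" "a3 = 1" using 5 nn by linarith
    then show ?thesis
    proof cases
      case 1
      have "n3\<^sup>2 = 0" unfolding pa(3) 1(2) by simp
      moreover have "\<bar>n2\<bar> = 2" using 1(1) defs(2) by simp
      ultimately have e: "n2 = -2" "C = 2" using n2 C by linarith+
      have "n1 = 2" using n1 unfolding e by simp
      then have "t = 2" using t e(2) by simp
      then show ?thesis using small e(2) by simp
    next
      case 2
      have "n3\<^sup>2 = 0" unfolding pa(3) 2(2) by simp
      moreover have "\<bar>n2\<bar> = 3" using 2(1) defs(2) by simp
      ultimately have e: "n2 = -3" "C = 3" using n2 C by linarith+
      have "n1 = 6" using n1 unfolding e by simp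
      then have "t = 33" using t e(2) by simp
      then show ?thesis using small e(2) by simp
    next
      case 3
      have "n3\<^sup>2 = 1" unfolding pa(3) 3(2) by simp
      moreover have "\<bar>n2\<bar> = 3" using 3(1) defs(2) by simp
      ultimately have e: "n2 = -3" "C = 4" using n2 C by linarith+
      have "n1 = 5" using n1 unfolding e by simp
      then have "t = 21" using t e(2) by simp
      then show ?thesis using small e(2) by simp
    qed
  qed
qed

section \<open>Words all of whose extensions are irreducible\<close>

definition irreducible_cone :: "nat \<Rightarrow> int set \<Rightarrow> int \<Rightarrow> int list \<Rightarrow> bool" where
  "irreducible_cone d S a v \<longleftrightarrow> (\<forall>w\<in>lists S. irreducible (word_poly d (a # v @ w)))"

lemma irreducible_coneI:
  assumes "d > 0" "irreducible (word_poly d (a # v))"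
    and "\<And>w j. w \<in> lists S \<Longrightarrow> j \<in> S \<Longrightarrow> avoids_powers d a (word_value d v (word_value d w j))"
  shows "irreducible_cone d S a v"
  unfolding irreducible_cone_def
proof
  fix w assume "w \<in> lists S"
  then show "irreducible (word_poly d (a # v @ w))"
    by (intro irreducible_word_append assms) auto
qed

lemma word_value_replicate_large:
  assumes "d \<ge> 2" "2 \<le> \<bar>a\<bar>" "\<bar>a\<bar> \<le> \<bar>x\<bar>"
  shows "\<bar>a\<bar> \<le> \<bar>word_value d (replicate k a) x\<bar>"
  using assms by (induction k) (auto intro: abs_orbit_mono)

lemma irreducible_word_replicate:
  assumes "d \<ge> 2" "irreducible (binomial_poly d a)" "2 \<le> \<bar>a\<bar>"
  shows "irreducible (word_poly d (a # replicate k a))"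
proof -
  have "irreducible (word_poly d (a # [] @ replicate k a))"
  proof (rule irreducible_word_append)
    fix x c y assume w: "replicate k a = x @ c # y"
    then have "set x \<subseteq> {a}" "c = a"
      by (metis Un_iff in_set_replicate list.set_intros(1) set_append subsetI singleton_iff)+
    then have "x = replicate (length x) a" by (metis replicate_eqI singletonD subsetD)
    then have "\<bar>a\<bar> \<le> \<bar>word_value d x c\<bar>"
      using word_value_replicate_large[OF assms(1,3), of a "length x"] \<open>c = a\<close> by simp
    then show "avoids_powers d a (word_value d [] (word_value d x c))"
      using avoids_powers_large[of d a] assms by simp
  qed (use assms in auto)
  then show ?thesis by simp
qed

text \<open>
  The set \<open>T\<close> collects the integers at which the iterate of \<open>x ^ d + a\<close> may fail the power test.
  The word \<open>w\<close> works if it keeps the integers that it meets out of \<open>T\<close>: the values of its prefixes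
  at its own letters, which decide about \<open>w\<close> itself, and the values of \<open>w\<close> on the orbits of the
  constants, which decide about everything appended later.
\<close>

lemma irreducible_cone_avoiding:
  assumes d: "d \<ge> 2" and a: "irreducible (binomial_poly d a)" "2 \<le> \<bar>a\<bar>"
    and T: "\<And>n. n \<notin> T \<Longrightarrow> avoids_powers d a (word_value d (replicate k a) n)"
    and prefix: "\<And>x c y. w = x @ c # y \<Longrightarrow> word_value d x c \<notin> T"
    and orbit: "\<And>u j. u \<in> lists S \<Longrightarrow> j \<in> S \<Longrightarrow> word_value d w (word_value d u j) \<notin> T"
  shows "irreducible_cone d S a (replicate k a @ w)"
proof (rule irreducible_coneI)
  show "irreducible (word_poly d (a # replicate k a @ w))"
  proof (rule irreducible_word_append)
    show "irreducible (word_poly d (a # replicate k a))"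
      using irreducible_word_replicate[OF d a] .
  qed (use d T prefix in auto)
qed (use d T orbit in \<open>auto simp: word_value_append\<close>)

lemma irreducible_cone_positive:
  assumes "d > 0" "irreducible (binomial_poly d a)" "0 < a" "even d"
  shows "irreducible_cone d S a [a]"
proof (rule irreducible_coneI)
  have "irreducible (word_poly d (a # [] @ [a]))"
    by (rule irreducible_word_append_letter) (use assms avoids_powers_positive[of d a a] in auto)
  then show "irreducible (word_poly d (a # [a]))" by simp
qed (use assms avoids_powers_positive[of d a] zero_le_even_power in auto)

lemma root_of_irreducible_binomial:
  assumes "d \<ge> 2" "irreducible (binomial_poly d a)"
  shows "r ^ d + a \<noteq> 0"
proof
  assume "r ^ d + a = 0"
  moreover have "poly (binomial_poly d a) (of_int r) = of_int (r ^ d + a)"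
    by (simp add: binomial_poly_def poly_monom)
  ultimately have "poly (binomial_poly d a) (of_int r) = 0" by simp
  then have "[:- of_int r, 1:] dvd binomial_poly d a" by (simp add: poly_eq_0_iff_dvd)
  then obtain q where q: "binomial_poly d a = [:- of_int r, 1:] * q" by (elim dvdE)
  then have "is_unit [:- of_int r, 1 :: rat:] \<or> is_unit q" using assms(2) irreducibleD by blast
  then have "is_unit q" by (auto simp: is_unit_iff_degree)
  moreover from this have "q \<noteq> 0" by auto
  ultimately have "degree q = 0" "q \<noteq> 0" by (auto simp: is_unit_iff_degree)
  then have "degree (binomial_poly d a) = 1"
    unfolding q by (subst degree_mult_eq) auto
  then show False using assms(1) by simp
qed

lemma irreducible_binomial_constant:
  assumes "d \<ge> 2" "irreducible (binomial_poly d a)"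
  shows "2 \<le> \<bar>a\<bar> \<or> (a = 1 \<and> even d)"
proof (rule ccontr)
  assume "\<not> ?thesis"
  then consider "a = 0" | "a = -1" | "a = 1" "odd d" by linarith
  then show False
    using root_of_irreducible_binomial[OF assms, of 0] root_of_irreducible_binomial[OF assms, of 1]
      root_of_irreducible_binomial[OF assms, of "-1"] assms(1)
    by cases (auto simp: power_0_left)
qed

lemma replicate_three: "replicate 3 a = [a, a, a]"
  by (simp add: numeral_3_eq_3)

lemma small_third_word_value:
  assumes "d \<ge> 3" "2 \<le> \<bar>a\<bar>" "t = word_value d (replicate 3 a) n" "\<bar>t\<bar> < \<bar>a\<bar>"
  shows "a = t - t ^ d \<and> (n = t \<or> (even d \<and> n = - t))"
  using small_third_iterate_is_fixed[OF assms(1,2) refl refl, of t n] assms(3,4)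
  by (simp add: replicate_three)

lemma third_iterate_avoids_powers:
  assumes d: "d \<ge> 3" and a: "2 \<le> \<bar>a\<bar>"
    and n: "\<And>t. a = t - t ^ d \<Longrightarrow> n \<noteq> t \<and> (even d \<longrightarrow> n \<noteq> - t)"
  shows "avoids_powers d a (word_value d (replicate 3 a) n)"
proof -
  let ?t = "word_value d (replicate 3 a) n"
  have "\<not> \<bar>?t\<bar> < \<bar>a\<bar>"
  proof
    assume "\<bar>?t\<bar> < \<bar>a\<bar>"
    then have "a = ?t - ?t ^ d \<and> (n = ?t \<or> (even d \<and> n = - ?t))"
      by (rule small_third_word_value[OF d a refl])
    then show False using n by blast
  qed
  then show ?thesis using avoids_powers_large[of d a ?t] d a by simp
qed

text \<open>
  The map \<open>x - x ^ d\<close> is injective on the integers apart from the solutions of \<open>x = x ^ d\<close>.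
\<close>

lemma fixed_point_unique:
  fixes a b t :: int
  assumes d: "d \<ge> 3" and b: "a = b - b ^ d" and t: "a = t - t ^ d" and a: "a \<noteq> 0"
  shows "t = b"
proof (rule ccontr)
  assume ne: "t \<noteq> b"
  have eq: "b ^ d - t ^ d = b - t" using b t by linarith
  show False
  proof (cases "\<bar>b\<bar> = \<bar>t\<bar>")
    case True
    then have "b = - t" using ne by auto
    then show ?thesis using eq ne b t a by (cases "even d") (auto simp: power_minus_odd)
  next
    case False
    have "\<bar>b\<bar> ^ (d - 1) + \<bar>t\<bar> ^ (d - 1) \<le> \<bar>\<bar>b\<bar> ^ d - \<bar>t\<bar> ^ d\<bar>"
      using power_gap'[of "\<bar>b\<bar>" "\<bar>t\<bar>" d] power_gap'[of "\<bar>t\<bar>" "\<bar>b\<bar>" d] False d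
      by (cases "\<bar>b\<bar> < \<bar>t\<bar>") auto
    moreover have "\<bar>b ^ d\<bar> = \<bar>b\<bar> ^ d" "\<bar>t ^ d\<bar> = \<bar>t\<bar> ^ d" by (auto simp: power_abs)
    ultimately have s: "\<bar>b\<bar> ^ (d - 1) + \<bar>t\<bar> ^ (d - 1) \<le> \<bar>b\<bar> + \<bar>t\<bar>" using eq by linarith
    have sq: "x ^ 2 \<le> x ^ (d - 1)" if "x \<ge> 0" for x :: int
      using d that by (intro power_mono_exp_int) auto
    have self: "x \<le> x ^ 2" if "x \<ge> 0" for x :: int using that by (cases "x = 0") (auto intro: self_le_power)
    have le1: "x \<le> 1" if "x ^ (d - 1) + y ^ (d - 1) \<le> x + y" "0 \<le> x" "0 \<le> y" for x y :: int
    proof (rule ccontr)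
      assume "\<not> x \<le> 1"
      then have "2 * x \<le> x ^ 2" unfolding power2_eq_square by (intro mult_right_mono) auto
      then show False using that(1) sq[OF that(2)] sq[OF that(3)] self[OF that(3)] \<open>\<not> x \<le> 1\<close> by linarith
    qed
    have "\<bar>b\<bar> \<le> 1" by (rule le1[OF s]) auto
    moreover have "\<bar>t\<bar> \<le> 1" by (rule le1[of _ "\<bar>b\<bar>"]) (use s in \<open>simp_all add: add.commute\<close>)
    ultimately have "b = 0 \<or> t = 0" using False by linarith
    then show ?thesis using a b t d by (auto simp: power_0_left)
  qed
qed

text \<open>
  If \<open>x = n ^ d + a\<close> satisfies \<open>\<bar>x ^ d + c\<bar> = \<bar>b\<bar>\<close>, then \<open>\<bar>x\<bar> < \<bar>b\<bar>\<close>. But \<open>n ^ d = b ^ d + (x - b)\<close>, and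
  the only \<open>d\<close>-th power that close to \<open>b ^ d\<close> is \<open>b ^ d\<close> itself, which would mean \<open>x = b\<close>.
\<close>

lemma preimage_of_small_constant:
  fixes a b c n :: int
  assumes d: "d \<ge> 3" and b: "2 \<le> \<bar>b\<bar>" and c: "\<bar>c\<bar> \<le> \<bar>b\<bar>" and a: "a = b - b ^ d"
  shows "\<bar>(n ^ d + a) ^ d + c\<bar> \<noteq> \<bar>b\<bar>"
proof
  define x where "x = n ^ d + a"
  assume "\<bar>(n ^ d + a) ^ d + c\<bar> = \<bar>b\<bar>"
  then have x: "\<bar>x ^ d\<bar> \<le> 2 * \<bar>b\<bar>" using c unfolding x_def by linarith
  have pa: "\<bar>y ^ d\<bar> = \<bar>y\<bar> ^ d" for y :: int by (rule power_abs)
  have sq: "2 * \<bar>b\<bar> \<le> \<bar>b\<bar> ^ 2" unfolding power2_eq_square using b by (intro mult_right_mono) auto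
  moreover have "\<bar>b\<bar> ^ 2 < \<bar>b\<bar> ^ d" using d b by (intro power_strict_increasing) auto
  ultimately have bd: "2 * \<bar>b\<bar> < \<bar>b ^ d\<bar>" by (simp add: pa)
  have xb: "\<bar>x\<bar> < \<bar>b\<bar>"
  proof (rule ccontr)
    assume "\<not> ?thesis"
    then have "\<bar>b\<bar> ^ d \<le> \<bar>x\<bar> ^ d" by (intro power_mono) auto
    then show False using x bd by (simp add: pa)
  qed
  have eq: "n ^ d - b ^ d = x - b" using a by (simp add: x_def)
  have "n ^ d \<noteq> b ^ d" using eq xb by auto
  then have "\<bar>b\<bar> ^ (d - 1) \<le> \<bar>n ^ d - b ^ d\<bar>"
  proof (cases "\<bar>n\<bar> = \<bar>b\<bar>")
    case True
    then have "\<bar>n ^ d\<bar> = \<bar>b ^ d\<bar>" by (simp add: pa)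
    then have "n ^ d = - (b ^ d)" using \<open>n ^ d \<noteq> b ^ d\<close> by linarith
    then have "\<bar>b\<bar> ^ d \<le> \<bar>n ^ d - b ^ d\<bar>" unfolding pa[symmetric] by linarith
    moreover have "\<bar>b\<bar> ^ (d - 1) \<le> \<bar>b\<bar> ^ d" using b by (intro power_increasing) auto
    ultimately show ?thesis by linarith
  next
    case False
    have "\<bar>b\<bar> ^ (d - 1) + \<bar>n\<bar> ^ (d - 1) \<le> \<bar>\<bar>b\<bar> ^ d - \<bar>n\<bar> ^ d\<bar>"
      using power_gap'[of "\<bar>b\<bar>" "\<bar>n\<bar>" d] power_gap'[of "\<bar>n\<bar>" "\<bar>b\<bar>" d] False d
      by (cases "\<bar>b\<bar> < \<bar>n\<bar>") auto
    moreover have "\<bar>\<bar>b\<bar> ^ d - \<bar>n\<bar> ^ d\<bar> \<le> \<bar>n ^ d - b ^ d\<bar>" unfolding pa[symmetric] by linarith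
    moreover have "0 \<le> \<bar>n\<bar> ^ (d - 1)" by simp
    ultimately show ?thesis by linarith
  qed
  moreover have "\<bar>b\<bar> ^ 2 \<le> \<bar>b\<bar> ^ (d - 1)" using d b by (intro power_increasing) auto
  ultimately show False using eq xb sq by linarith
qed

lemma append_Cons_eq_short:
  "[p, q] = x @ c # y \<longleftrightarrow> (x = [] \<and> c = p \<and> y = [q]) \<or> (x = [p] \<and> c = q \<and> y = [])"
  by (auto simp: Cons_eq_append_conv)

lemma word_value_prefix_large:
  assumes "d \<ge> 2" "2 \<le> \<bar>c\<bar>" "replicate k c = x @ e # y"
  shows "\<bar>c\<bar> \<le> \<bar>word_value d x e\<bar>"
proof -
  have "set x \<subseteq> {c}" "e = c"
    using assms(3) by (metis Un_iff in_set_replicate list.set_intros(1) set_append subsetI singleton_iff)+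
  then have "x = replicate (length x) c" by (metis replicate_eqI singletonD subsetD)
  then show ?thesis
    using word_value_replicate_large[OF assms(1,2), of c "length x"] \<open>e = c\<close> by simp
qed

lemma irreducible_cone_without_fixed_point:
  assumes "d \<ge> 3" "irreducible (binomial_poly d a)" "2 \<le> \<bar>a\<bar>" "\<And>t. a \<noteq> t - t ^ d"
  shows "irreducible_cone d S a (replicate 3 a @ [])"
  by (rule irreducible_cone_avoiding[where T = "{}"])
    (use assms third_iterate_avoids_powers[of d a] in auto)

text \<open>
  If \<open>\<bar>c\<bar> \<le> \<bar>b\<bar>\<close>, the word \<open>[c, a]\<close> never takes a value \<open>\<plusminus>b\<close>. If \<open>\<bar>c\<bar> > \<bar>b\<bar>\<close>, three letters \<open>c\<close>
  suffice: a value of size \<open>\<bar>b\<bar>\<close> would be small for \<open>x ^ d + c\<close> and hence a fixed point of it, so that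
  \<open>c\<close> would be \<open>a\<close> or \<open>- b - b ^ d\<close>.
\<close>

lemma irreducible_cone_escaping_fixed_point:
  assumes d: "d \<ge> 3" and a: "irreducible (binomial_poly d a)" "2 \<le> \<bar>a\<bar>" and b: "a = b - b ^ d"
    and c: "c \<noteq> a" "c \<noteq> b" "even d \<Longrightarrow> c \<noteq> - b" "even d \<Longrightarrow> c \<noteq> - b - b ^ d"
  shows "\<exists>w\<in>lists {a, c}. irreducible_cone d S a (replicate 3 a @ w)"
proof -
  define T where "T = (if even d then {b, - b} else {b})"
  have T: "x \<in> T \<Longrightarrow> \<bar>x\<bar> = \<bar>b\<bar>" for x by (auto simp: T_def split: if_splits)
  have avoid: "avoids_powers d a (word_value d (replicate 3 a) n)" if "n \<notin> T" for n
  proof (rule third_iterate_avoids_powers[OF d a(2)])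
    fix t assume "a = t - t ^ d"
    then have "t = b" using fixed_point_unique[OF d b, of t] a(2) by auto
    then show "n \<noteq> t \<and> (even d \<longrightarrow> n \<noteq> - t)" using that by (auto simp: T_def split: if_splits)
  qed
  note cone = irreducible_cone_avoiding[where T = T and k = 3 and S = S, OF _ a avoid]
  show ?thesis
  proof (cases "\<bar>c\<bar> \<le> \<bar>b\<bar>")
    case True
    have "b \<noteq> 0" "b \<noteq> 1" using a(2) b d by (auto simp: power_0_left)
    moreover have "b \<noteq> -1"
    proof
      assume "b = -1"
      moreover have "even d" using \<open>b = -1\<close> a(2) b by (cases "even d") auto
      ultimately show False using c True by auto
    qed
    ultimately have b2: "2 \<le> \<bar>b\<bar>" by linarith
    \<comment> \<open>the first integer that \<open>[c, a]\<close> meets after \<open>c\<close> is the value at the constant \<open>a\<close>, that is, the case \<open>n = 0\<close>\<close>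
    have "irreducible_cone d S a (replicate 3 a @ [c, a])"
    proof (rule cone)
      have "\<bar>b\<bar> \<noteq> \<bar>a ^ d + c\<bar>"
        using preimage_of_small_constant[OF d b2 True b, of 0] d by (simp add: power_0_left)
      moreover have "c \<notin> T" using c by (auto simp: T_def)
      ultimately show "word_value d x e \<notin> T" if "[c, a] = x @ e # y" for x e y
        using that T[of "a ^ d + c"] by (auto simp: append_Cons_eq_short)
      show "word_value d [c, a] (word_value d u j) \<notin> T" for u j
        using preimage_of_small_constant[OF d b2 True b, of "word_value d u j"]
          T[of "word_value d [c, a] (word_value d u j)"] by auto
    qed (use d in auto)
    then show ?thesis by (intro bexI[of _ "[c, a]"]) auto
  next
    case False
    have "b \<noteq> 0" using a(2) b d by (auto simp: power_0_left)
    then have c2: "2 \<le> \<bar>c\<bar>" using False by linarith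
    have "irreducible_cone d S a (replicate 3 a @ replicate 3 c)"
    proof (rule cone)
      show "word_value d x e \<notin> T" if "replicate 3 c = x @ e # y" for x e y
        using word_value_prefix_large[OF _ c2 that, of d] d T[of "word_value d x e"] False by auto
      fix u j
      let ?t = "word_value d (replicate 3 c) (word_value d u j)"
      show "?t \<notin> T"
      proof
        assume t: "?t \<in> T"
        then have "\<bar>?t\<bar> < \<bar>c\<bar>" using T[OF t] False by linarith
        then have "c = ?t - ?t ^ d"
          using small_third_word_value[OF d c2 refl] by blast
        then show False using t c b by (auto simp: T_def split: if_splits)
      qed
    qed (use d in auto)
    then show ?thesis by (intro bexI[of _ "replicate 3 c"]) auto
  qed
qed

section \<open>Quadratic generators\<close>

lemma avoids_powers_2_iff: "avoids_powers 2 a t \<longleftrightarrow> (\<forall>y. t\<^sup>2 + a \<noteq> y\<^sup>2)"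
  unfolding avoids_powers_def by (metis dvd_refl primes_dvd_imp_eq two_is_prime_nat)

lemma square_between:
  fixes k x m :: int
  assumes "0 \<le> k" "k\<^sup>2 < m" "m < (k + 1)\<^sup>2"
  shows "x\<^sup>2 \<noteq> m"
  using between_consecutive_powers[of k 2 m x] assms by auto

text \<open>
  At a fixed point \<open>t\<close> the tested number \<open>t ^ 2 - C\<close> is \<open>t\<close> itself, and on a two-cycle it is the
  other point of the cycle. So only fixed points and two-cycles that contain a square can do harm.
\<close>

lemma third_iterate_avoids_squares:
  assumes C: "2 \<le> C"
    and A: "\<And>y. C = (y\<^sup>2)\<^sup>2 - y\<^sup>2 \<Longrightarrow> n\<^sup>2 \<noteq> (y\<^sup>2)\<^sup>2"
    and B: "\<And>y. C = (y\<^sup>2)\<^sup>2 + y\<^sup>2 + 1 \<Longrightarrow> n\<^sup>2 \<noteq> (y\<^sup>2)\<^sup>2"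
  shows "avoids_powers 2 (- C) (word_value 2 (replicate 3 (- C)) n)"
proof -
  let ?t = "word_value 2 (replicate 3 (- C)) n"
  show ?thesis
  proof (cases "\<bar>?t\<bar> < C")
    case False
    then show ?thesis using avoids_powers_large[of 2 "- C" ?t] C by simp
  next
    case True
    have q: "(C = ?t\<^sup>2 - ?t \<and> n\<^sup>2 = ?t\<^sup>2) \<or> (C = ?t\<^sup>2 + ?t + 1 \<and> n\<^sup>2 = (?t + 1)\<^sup>2)"
      by (rule small_third_iterate_quadratic[OF C refl refl _ True]) (simp add: replicate_three)
    show ?thesis
      unfolding avoids_powers_2_iff
    proof (intro allI notI)
      fix y assume y: "?t\<^sup>2 + - C = y\<^sup>2"
      from q show False
      proof (elim disjE conjE)
        assume "C = ?t\<^sup>2 - ?t" "n\<^sup>2 = ?t\<^sup>2"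
        moreover from this y have "?t = y\<^sup>2" by simp
        ultimately show False using A[of y] by simp
      next
        assume h: "C = ?t\<^sup>2 + ?t + 1" "n\<^sup>2 = (?t + 1)\<^sup>2"
        then have t: "?t = - y\<^sup>2 - 1" using y by simp
        have "C = (y\<^sup>2)\<^sup>2 + y\<^sup>2 + 1" using h(1) unfolding t by (simp add: power2_eq_square algebra_simps)
        moreover have "n\<^sup>2 = (y\<^sup>2)\<^sup>2" using h(2) unfolding t by (simp add: power2_eq_square algebra_simps)
        ultimately show False using B[of y] by blast
      qed
    qed
  qed
qed

lemma small_third_word_value_quadratic:
  assumes "2 \<le> C" "t = word_value 2 (replicate 3 (- C)) n" "\<bar>t\<bar> < C"
  shows "(C = t\<^sup>2 - t \<and> n\<^sup>2 = t\<^sup>2) \<or> (C = t\<^sup>2 + t + 1 \<and> n\<^sup>2 = (t + 1)\<^sup>2)"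
  by (rule small_third_iterate_quadratic[OF assms(1) refl refl _ assms(3)]) (simp add: assms(2) replicate_three)

lemma irreducible_binomial_2:
  assumes "\<And>r. r\<^sup>2 + c \<noteq> 0"
  shows "irreducible (binomial_poly 2 c)"
proof -
  have "irreducible (pcompose [:of_int c, 1 :: rat:] (monom 1 2))"
  proof (rule irreducible_power_substitution)
    show "irreducible [:of_int c, 1 :: rat:]" by (rule irreducible_linear_field_poly) simp
    fix r :: rat
    show "(-1) ^ degree [:of_int c, 1 :: rat:] * coeff [:of_int c, 1:] 0 \<noteq> r ^ 2"
    proof
      assume "(-1) ^ degree [:of_int c, 1 :: rat:] * coeff [:of_int c, 1:] 0 = r ^ 2"
      then have r: "r ^ 2 = of_int (- c)" by simp
      then obtain y where "r = of_int y" using rat_root_of_int by (metis zero_less_numeral)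
      then have "of_int (y\<^sup>2) = (of_int (- c) :: rat)" using r by simp
      then have "y\<^sup>2 + c = 0" by (simp only: of_int_eq_iff)
      then show False using assms by blast
    qed
  qed (auto simp: two_is_prime_nat)
  then show ?thesis by (simp add: binomial_poly_def pcompose_pCons add.commute)
qed

text \<open>
  The right-hand side divided by two lies strictly between the squares of \<open>Y ^ 2 + h - 1\<close> and
  \<open>Y ^ 2 + h\<close>, because \<open>h\<close> is of the order of \<open>Y\<close>.
\<close>

lemma no_quartic_splitting:
  fixes Y h k :: int
  assumes Y: "2 \<le> \<bar>Y\<bar>" and h: "2 * h\<^sup>2 = Y * (Y + 1)"
  shows "2 * k\<^sup>2 \<noteq> 2 * (Y\<^sup>2 + h)\<^sup>2 - (Y\<^sup>2 - Y)"
proof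
  assume k: "2 * k\<^sup>2 = 2 * (Y\<^sup>2 + h)\<^sup>2 - (Y\<^sup>2 - Y)"
  define Z where "Z = Y\<^sup>2 + h"
  have y2: "2 * \<bar>Y\<bar> \<le> Y\<^sup>2" using Y mult_right_mono[of 2 "\<bar>Y\<bar>" "\<bar>Y\<bar>"] by (simp add: power2_eq_square)
  have "2 * h\<^sup>2 \<le> 2 * Y\<^sup>2" using h y2 by (simp add: power2_eq_square algebra_simps)
  then have h_le: "\<bar>h\<bar> \<le> \<bar>Y\<bar>" by (simp add: abs_le_square_iff)
  have "k\<^sup>2 < Z\<^sup>2" using k y2 Y unfolding Z_def[symmetric] by linarith
  show False
  proof (cases "\<bar>Y\<bar> = 2")
    case True
    then have "Y = 2 \<or> Y = -2" by auto
    then have "h\<^sup>2 = 3 \<or> (Y = -2 \<and> h\<^sup>2 = 1)" using h by auto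
    then have "(Y = -2 \<and> (h = 1 \<or> h = -1))"
      using square_between[of 1 3 h] by (auto simp: power2_eq_1_iff)
    then have "k\<^sup>2 = 22 \<or> k\<^sup>2 = 6" using k by auto
    then show False using square_between[of 4 22 k] square_between[of 2 6 k] by auto
  next
    case False
    then have "3 * \<bar>Y\<bar> \<le> Y\<^sup>2" using Y mult_right_mono[of 3 "\<bar>Y\<bar>" "\<bar>Y\<bar>"] by (simp add: power2_eq_square)
    moreover have "3 \<le> \<bar>Y\<bar>" "- \<bar>Y\<bar> \<le> Y" "- \<bar>Y\<bar> \<le> h" using False Y h_le by auto
    ultimately have "0 < 3 * Y\<^sup>2 + 4 * h + Y - 2" "Z \<ge> 1" unfolding Z_def by linarith+
    then have "Y\<^sup>2 - Y < 4 * Z - 2" "Z \<ge> 1" by (auto simp: Z_def)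
    then have "(Z - 1)\<^sup>2 < k\<^sup>2" using k unfolding Z_def[symmetric] by (simp add: power2_eq_square algebra_simps)
    then show False
      using square_between[of "Z - 1" "k\<^sup>2" k] \<open>k\<^sup>2 < Z\<^sup>2\<close> \<open>Z \<ge> 1\<close> by simp
  qed
qed

text \<open>
  The four equations compare coefficients in a factorization of the composition of \<open>[a, a, - b]\<close>,
  where \<open>a = b - b ^ 2\<close>, into \<open>P(x) * P(- x)\<close>, where \<open>P\<close> has the coefficients \<open>p0\<close>, ..., \<open>p3\<close>, \<open>1\<close>.
  Eliminating all unknowns but \<open>\<rho> = p3 ^ 2 / 4\<close> completes a square and forces \<open>8 * Y * (Y + 1)\<close> to be
  a square, with \<open>Y = p0\<close>; the remaining quadratic equation for \<open>\<rho>\<close> has no rational solution by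
  \<open>no_quartic_splitting\<close>.
\<close>

lemma no_rational_quartic_splitting:
  fixes p0 p1 p2 p3 :: rat and y :: int
  assumes y: "2 \<le> y" and b: "b = of_int (y\<^sup>2)"
    and e0: "p0\<^sup>2 = b" and e1: "2 * p0 * p2 - p1\<^sup>2 = - 4 * b\<^sup>2"
    and e2: "p2\<^sup>2 + 2 * p0 - 2 * p1 * p3 = 4 * b\<^sup>2 + 2 * b" and e3: "2 * p2 - p3\<^sup>2 = - 4 * b"
  shows False
proof -
  have "p0\<^sup>2 = (of_int y)\<^sup>2" using e0 b by simp
  then have "p0 = of_int y \<or> p0 = of_int (- y)" by (simp add: power2_eq_iff)
  then obtain Y where Y: "p0 = of_int Y" "Y = y \<or> Y = - y" by blast
  define c :: rat where "c = of_int Y"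
  have bc: "b = c\<^sup>2" and p0: "p0 = c" using Y b by (auto simp: c_def)
  define \<rho> where "\<rho> = p3\<^sup>2 / 4"
  have p2: "p2 = 2 * \<rho> - 2 * c\<^sup>2" using e3 by (simp add: \<rho>_def bc)
  have p1: "p1\<^sup>2 = 4 * c ^ 4 + 4 * c * (\<rho> - c\<^sup>2)"
    using e1 by (simp add: p0 p2 bc algebra_simps power2_eq_square power4_eq_xxxx)
  have "2 * (p1 * p3) = 4 * \<rho>\<^sup>2 - 8 * c\<^sup>2 * \<rho> - 2 * (c\<^sup>2 - c)"
    using e2 by (simp add: p0 p2 bc algebra_simps power2_eq_square)
  then have "p1 * p3 = 2 * \<rho>\<^sup>2 - 4 * c\<^sup>2 * \<rho> - (c\<^sup>2 - c)" by (simp add: algebra_simps)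
  then have "(p1 * p3)\<^sup>2 = (2 * \<rho>\<^sup>2 - 4 * c\<^sup>2 * \<rho> - (c\<^sup>2 - c))\<^sup>2" by simp
  moreover have "(p1 * p3)\<^sup>2 = (4 * c ^ 4 + 4 * c * (\<rho> - c\<^sup>2)) * (4 * \<rho>)"
    by (simp add: power_mult_distrib p1 \<rho>_def)
  ultimately have sq: "(2 * \<rho>\<^sup>2 - 4 * c\<^sup>2 * \<rho> + (c\<^sup>2 - c))\<^sup>2 = 8 * c * (c + 1) * \<rho>\<^sup>2"
    by (simp add: algebra_simps power2_eq_square power4_eq_xxxx)
  have Y2: "2 \<le> \<bar>Y\<bar>" using Y y by auto
  have rho: "\<rho> \<noteq> 0"
  proof
    assume "\<rho> = 0"
    then have "c\<^sup>2 = c" using sq by simp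
    then have "c = 0 \<or> c = 1" by (simp add: power2_eq_square)
    then show False using Y2 by (auto simp: c_def)
  qed
  \<comment> \<open>the square root of \<open>8 * Y * (Y + 1)\<close>; it is an integer divisible by four\<close>
  define g where "g = (2 * \<rho>\<^sup>2 - 4 * c\<^sup>2 * \<rho> + (c\<^sup>2 - c)) / \<rho>"
  have gr: "g * \<rho> = 2 * \<rho>\<^sup>2 - 4 * c\<^sup>2 * \<rho> + (c\<^sup>2 - c)" using rho by (simp add: g_def)
  have "g\<^sup>2 = of_int (8 * Y * (Y + 1))"
    using sq rho by (simp add: g_def power_divide c_def field_simps)
  moreover from this obtain G where G: "g = of_int G" using rat_root_of_int by (metis zero_less_numeral)
  ultimately have "of_int (G\<^sup>2) = (of_int (8 * Y * (Y + 1)) :: rat)" by simp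
  then have G2: "G\<^sup>2 = 8 * Y * (Y + 1)" by (simp only: of_int_eq_iff)
  then have "even G" by (metis dvd_mult2 even_numeral even_power dvd_triv_left even_mult_iff)
  then obtain G1 where G1: "G = 2 * G1" by (elim evenE)
  then have "G1\<^sup>2 = 2 * Y * (Y + 1)" using G2 by (simp add: power2_eq_square)
  then have "even G1" by (metis even_mult_iff even_numeral even_power)
  then obtain h where h: "G = 4 * h" using G1 by (auto elim!: evenE)
  then have h2: "2 * h\<^sup>2 = Y * (Y + 1)" using G2 by (simp add: power2_eq_square)
  have "2 * (\<rho> - (c\<^sup>2 + of_int h))\<^sup>2 = 2 * (c\<^sup>2 + of_int h)\<^sup>2 - (c\<^sup>2 - c)"
    using gr unfolding G h by (simp add: power2_eq_square algebra_simps)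
  moreover have "even (Y\<^sup>2 - Y)" by simp
  then obtain W where W: "Y\<^sup>2 - Y = 2 * W" by (elim evenE)
  have "c\<^sup>2 - c = of_int (2 * W)" unfolding W[symmetric] by (simp add: c_def)
  ultimately have "(\<rho> - (c\<^sup>2 + of_int h))\<^sup>2 = of_int ((Y\<^sup>2 + h)\<^sup>2 - W)" by (simp add: c_def)
  moreover from this obtain k where k: "\<rho> - (c\<^sup>2 + of_int h) = of_int k" using rat_root_of_int by (metis zero_less_numeral)
  ultimately have "of_int (k\<^sup>2) = (of_int ((Y\<^sup>2 + h)\<^sup>2 - W) :: rat)" by simp
  then have "k\<^sup>2 = (Y\<^sup>2 + h)\<^sup>2 - W" by (simp only: of_int_eq_iff)
  then show False using no_quartic_splitting[OF Y2 h2, of k] W by simp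
qed

lemma degree_four_monic:
  fixes g :: "rat poly"
  assumes "lead_coeff g = 1" "degree g = 4"
  obtains p0 p1 p2 p3 where "g = [:p0, p1, p2, p3, 1:]"
proof (rule that)
  show "g = [:coeff g 0, coeff g 1, coeff g 2, coeff g 3, 1:]"
  proof (rule poly_eqI)
    fix n
    have c4: "coeff g 4 = 1" using assms by simp
    have big: "n > 4 \<Longrightarrow> coeff g n = 0" using assms(2) by (intro coeff_eq_0) simp
    have big': "n > 4 \<Longrightarrow> coeff [:coeff g 0, coeff g 1, coeff g 2, coeff g 3, 1:] n = 0"
      by (intro coeff_eq_0) simp
    consider "n = 0" | "n = 1" | "n = 2" | "n = 3" | "n = 4" | "n > 4" by linarith
    then show "coeff g n = coeff [:coeff g 0, coeff g 1, coeff g 2, coeff g 3, 1:] n"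
      using c4 big big' by cases (simp_all add: numeral_eq_Suc)
  qed
qed

text \<open>
  The norm criterion is silent here, since the second iterate of \<open>x ^ 2 + a\<close> has the square value
  \<open>b\<close> at \<open>- b\<close>. A proper factor must have degree four by \<open>factor_of_power_substitution\<close>. Split it
  into even and odd part; then the quartic \<open>h\<close> equals the even part squared minus \<open>x\<close> times the odd
  part squared, which is impossible by comparison of coefficients.
\<close>

lemma irreducible_second_iterate_append:
  fixes y b a :: int
  assumes y: "2 \<le> y" and b: "b = y\<^sup>2" and a: "a = b - b\<^sup>2" and irr: "irreducible (word_poly 2 [a, a])"
  shows "irreducible (word_poly 2 [a, a, - b])"
proof (rule ccontr)
  assume red: "\<not> irreducible (word_poly 2 [a, a, - b])"
  define B :: rat where "B = of_int b"
  define h :: "rat poly" where "h = [:B, - 4 * B\<^sup>2, 4 * B\<^sup>2 + 2 * B, - 4 * B, 1:]"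
  have aB: "of_int a = B - B\<^sup>2" by (simp add: a B_def)
  have hh: "h = pcompose (word_poly 2 [a, a]) [:- B, 1:]"
    by (simp add: h_def binomial_poly_def monom_altdef pcompose_pCons aB power2_eq_square numeral_2_eq_2 algebra_simps)
  have h: "irreducible h" unfolding hh by (rule irreducible_translate[OF irr])
  have hm: "lead_coeff h = 1" "degree h = 4" by (simp_all add: h_def)
  have w: "word_poly 2 [a, a, - b] = pcompose h (monom 1 2)"
    unfolding hh by (simp add: pcompose_assoc[symmetric] binomial_poly_def B_def pcompose_pCons add.commute)
  obtain g where g: "lead_coeff g = 1" "g dvd pcompose h (monom 1 2)" "0 < degree g" "degree g < 4 * 2"
    using monic_factor_if_reducible[OF red] unfolding w by (auto simp: hm)
  obtain k where "degree g = k * 4"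
    using factor_of_power_substitution[OF h hm(1) g(1) _ g(2)] hm by auto
  then have "degree g = 4" using g(3,4) by (cases k) auto
  then obtain p0 p1 p2 p3 where gp: "g = [:p0, p1, p2, p3, 1:]" using degree_four_monic g(1) by metis
  define q where "q = [:p0, p2, 1:]\<^sup>2 - [:0, 1:] * [:p1, p3:]\<^sup>2"
  have qe: "q = [:p0\<^sup>2, 2 * p0 * p2 - p1\<^sup>2, p2\<^sup>2 + 2 * p0 - 2 * p1 * p3, 2 * p2 - p3\<^sup>2, 1:]"
    by (simp add: q_def power2_eq_square algebra_simps)
  obtain z where z: "poly (cpx g) z = 0"
    using g(3) by (metis degree_cpx constant_degree fundamental_theorem_of_algebra not_gr_zero)
  have "poly (cpx (pcompose h (monom 1 2))) z = 0"
    using g(2) z by (metis cpx_simps(3) dvdE mult_zero_left poly_mult)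
  then have hz: "poly (cpx h) (z\<^sup>2) = 0" by (simp add: poly_pcompose map_poly_monom poly_monom)
  let ?e = "poly (cpx [:p0, p2, 1:]) (z\<^sup>2)" and ?o = "poly (cpx [:p1, p3:]) (z\<^sup>2)"
  have "?e + z * ?o = 0" using z by (simp add: gp power2_eq_square algebra_simps)
  then have "?e = - (z * ?o)" by (simp add: eq_neg_iff_add_eq_0)
  then have "?e\<^sup>2 = z\<^sup>2 * ?o\<^sup>2" by (simp add: power_mult_distrib)
  then have "poly (cpx q) (z\<^sup>2) = 0" unfolding q_def cpx_simps cpx_power by simp
  then have "h dvd q" using irreducible_dvd_if_common_complex_root[OF h hz] by blast
  then obtain s where s: "q = h * s" by (elim dvdE)
  have dq: "degree q = 4" "lead_coeff q = 1" by (simp_all add: qe)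
  then have s0: "s \<noteq> 0" "h \<noteq> 0" using s by auto
  then have "degree s = 0" using dq(1) hm(2) degree_mult_eq[of h s] s by simp
  moreover have "lead_coeff s = 1" using dq(2) hm(1) s by (simp add: lead_coeff_mult)
  ultimately have "s = 1" by (auto elim!: degree_eq_zeroE)
  then have "q = h" using s by simp
  then have "p0\<^sup>2 = B" "2 * p0 * p2 - p1\<^sup>2 = - 4 * B\<^sup>2" "p2\<^sup>2 + 2 * p0 - 2 * p1 * p3 = 4 * B\<^sup>2 + 2 * B"
    "2 * p2 - p3\<^sup>2 = - 4 * B"
    unfolding qe h_def by simp_all
  then show False using no_rational_quartic_splitting[OF y] by (simp add: B_def b)
qed

section \<open>Steering away from fixed points and two-cycles of quadratic generators\<close>

lemma square_between':
  fixes k x m :: int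
  assumes "x\<^sup>2 = m" "0 \<le> k" "k\<^sup>2 < m" "m < (k + 1)\<^sup>2"
  shows False
  using square_between[OF assms(2-4), of x] assms(1) by simp

lemma words_avoid_closed_set:
  assumes "\<And>j. j \<in> S \<Longrightarrow> j \<notin> Z" "\<And>c x. c \<in> S \<Longrightarrow> x\<^sup>2 + c \<in> Z \<Longrightarrow> x \<in> Z"
    and "u \<in> lists S" "j \<in> S"
  shows "word_value 2 u j \<notin> Z"
  using assms(3)
proof (induction u)
  case Nil
  show ?case using assms(1,4) by simp
next
  case (Cons c u)
  then have "word_value 2 u j \<notin> Z" "c \<in> S" by auto
  then show ?case using assms(2) by auto
qed

text \<open>
  For these three constants the set of all \<open>\<plusminus>b\<close> and \<open>\<plusminus>(b - 1)\<close> contains its own preimages, so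
  the orbit of a constant outside the set never enters it.
\<close>

lemma irreducible_cone_square_fixed_point_closed:
  assumes a: "irreducible (binomial_poly 2 (b - b\<^sup>2))" and b: "4 \<le> b"
    and avoid: "\<And>n. n\<^sup>2 \<noteq> b\<^sup>2 \<Longrightarrow> avoids_powers 2 (b - b\<^sup>2) (word_value 2 (replicate 3 (b - b\<^sup>2)) n)"
    and S: "S \<subseteq> {b - b\<^sup>2, - (b\<^sup>2 + b), - (b\<^sup>2 - b + 1)}"
  shows "irreducible_cone 2 S (b - b\<^sup>2) (replicate 3 (b - b\<^sup>2) @ [])"
proof (rule irreducible_cone_avoiding[where T = "{n. n\<^sup>2 = b\<^sup>2}"])
  have bb: "4 * b \<le> b\<^sup>2" using b by (simp add: power2_eq_square)
  define Z where "Z = {n. n\<^sup>2 = b\<^sup>2 \<or> n\<^sup>2 = (b - 1)\<^sup>2}"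
  have abs: "n \<in> Z \<longleftrightarrow> n = b \<or> n = - b \<or> n = b - 1 \<or> n = - (b - 1)" for n
    by (auto simp: Z_def power2_eq_iff)
  fix u j assume uj: "u \<in> lists S" "j \<in> S"
  have "word_value 2 u j \<notin> Z"
  proof (rule words_avoid_closed_set[OF _ _ uj])
    fix j assume "j \<in> S"
    then show "j \<notin> Z" using S bb b by (auto simp: abs)
  next
    fix c x assume c: "c \<in> S" and x: "x\<^sup>2 + c \<in> Z"
    have sq: "x\<^sup>2 \<noteq> b\<^sup>2 - 2 * b" "x\<^sup>2 \<noteq> b\<^sup>2 - 1" "x\<^sup>2 \<noteq> b\<^sup>2 + 2 * b" "x\<^sup>2 \<noteq> b\<^sup>2 + 2 * b - 1"
      "x\<^sup>2 \<noteq> b\<^sup>2 + 1" "x\<^sup>2 \<noteq> b\<^sup>2 - 2 * b + 2"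
      using b square_between[of "b - 2" "b\<^sup>2 - 2 * b" x] square_between[of "b - 1" "b\<^sup>2 - 1" x]
        square_between[of "b" "b\<^sup>2 + 2 * b" x] square_between[of "b" "b\<^sup>2 + 2 * b - 1" x]
        square_between[of "b" "b\<^sup>2 + 1" x] square_between[of "b - 1" "b\<^sup>2 - 2 * b + 2" x]
      by (auto simp: power2_eq_square algebra_simps)
    have Z': "x\<^sup>2 = b\<^sup>2 \<or> x\<^sup>2 = b\<^sup>2 - 2 * b + 1 \<Longrightarrow> x \<in> Z"
      by (auto simp: Z_def power2_eq_square algebra_simps)
    have "c = b - b\<^sup>2 \<or> c = - (b\<^sup>2 + b) \<or> c = - (b\<^sup>2 - b + 1)" using c S by auto
    moreover have "x\<^sup>2 = b - c \<or> x\<^sup>2 = - b - c \<or> x\<^sup>2 = b - 1 - c \<or> x\<^sup>2 = 1 - b - c"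
      using x by (auto simp: abs)
    ultimately show "x \<in> Z" using sq Z' by (elim disjE) auto
  qed
  then show "word_value 2 [] (word_value 2 u j) \<notin> {n. n\<^sup>2 = b\<^sup>2}" by (simp add: Z_def)
next
  have bb: "4 * b \<le> b\<^sup>2" using b by (simp add: power2_eq_square)
  show "2 \<le> \<bar>b - b\<^sup>2\<bar>" using bb b by linarith
qed (use a avoid in auto)

lemma abs_less_if_square_le:
  fixes x m :: int
  assumes "x\<^sup>2 \<le> 2 * m + 1" "4 \<le> m"
  shows "\<bar>x\<bar> < m"
proof (rule ccontr)
  assume "\<not> \<bar>x\<bar> < m"
  then have "m * m \<le> \<bar>x\<bar> * \<bar>x\<bar>" using assms(2) by (intro mult_mono) auto
  moreover have "4 * m \<le> m * m" using assms(2) by simp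
  moreover have "\<bar>x\<bar> * \<bar>x\<bar> = x\<^sup>2" by (simp add: power2_eq_square)
  ultimately show False using assms by linarith
qed

text \<open>
  If all constants are among the three of the previous lemma, that lemma applies. For another
  constant \<open>c\<close>, four situations arise. If \<open>\<bar>c\<bar> < b\<close>, the word \<open>[c, a]\<close> takes no value
  \<open>\<plusminus>b\<close>. If \<open>c = - b\<close>, the norm criterion fails, but the composition of \<open>[a, a, - b]\<close> is irreducible
  and the word \<open>[a, - b]\<close> has large values at all values of the third iterate of \<open>x ^ 2 + a\<close>. If \<open>\<bar>c\<bar> > b\<close>, three
  letters \<open>c\<close> avoid \<open>\<plusminus>b\<close>, unless \<open>b\<close> lies on the two-cycle of \<open>x ^ 2 + c\<close>; then a further letter \<open>a\<close>
  shifts away from the cycle.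
\<close>

lemma irreducible_cone_square_fixed_point:
  assumes a: "irreducible (binomial_poly 2 (b - b\<^sup>2))" and y: "b = y\<^sup>2" "2 \<le> y"
    and avoid: "\<And>n. n\<^sup>2 \<noteq> b\<^sup>2 \<Longrightarrow> avoids_powers 2 (b - b\<^sup>2) (word_value 2 (replicate 3 (b - b\<^sup>2)) n)"
    and S: "b - b\<^sup>2 \<in> S" "\<And>c. c \<in> S \<Longrightarrow> c \<le> 0"
  shows "\<exists>v\<in>lists S. irreducible_cone 2 S (b - b\<^sup>2) v"
proof -
  define a where "a = b - b\<^sup>2"
  have b: "4 \<le> b" using y power_mono[of 2 y 2] by simp
  have bb: "4 * b \<le> b\<^sup>2" using b by (simp add: power2_eq_square)
  then have bbb: "4 * b\<^sup>2 \<le> b * b\<^sup>2" "4 * (b * b\<^sup>2) \<le> b\<^sup>2 * b\<^sup>2" using b by (simp_all add: power2_eq_square)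
  have a2: "2 \<le> \<bar>a\<bar>" "a \<in> S" and airr: "irreducible (binomial_poly 2 a)"
    using bb b S(1) assms(1) by (auto simp: a_def)
  have sqa: "2 * b\<^sup>2 + 2 * b + 2 \<le> a\<^sup>2"
  proof -
    have "a\<^sup>2 = b\<^sup>2 * b\<^sup>2 - 2 * (b * b\<^sup>2) + b\<^sup>2" by (simp add: a_def power2_eq_square algebra_simps)
    then show ?thesis using bbb bb b by linarith
  qed
  define T where "T = {n. n\<^sup>2 = b\<^sup>2}"
  have T: "n \<in> T \<longleftrightarrow> \<bar>n\<bar> = b" for n using b by (auto simp: T_def power2_eq_iff abs_if)
  have T': "n \<in> T \<longleftrightarrow> n = b \<or> n = - b" for n by (auto simp: T_def power2_eq_iff)
  note cone = irreducible_cone_avoiding[where T = T and k = 3 and S = S and d = 2 and a = a, OF _ airr a2(1)]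
  have av: "avoids_powers 2 a (word_value 2 (replicate 3 a) n)" if "n \<notin> T" for n
    using avoid[of n] that by (simp add: a_def T_def)
  show ?thesis
  proof (cases "S \<subseteq> {b - b\<^sup>2, - (b\<^sup>2 + b), - (b\<^sup>2 - b + 1)}")
    case True
    then have "irreducible_cone 2 S a (replicate 3 a @ [])"
      using irreducible_cone_square_fixed_point_closed[OF assms(1) b avoid] by (simp add: a_def)
    then show ?thesis using a2(2) unfolding a_def by (intro bexI) auto
  next
    case False
    then obtain c where c: "c \<in> S" "c \<noteq> a" "c \<noteq> - (b\<^sup>2 + b)" "c \<noteq> - (b\<^sup>2 - b + 1)" by (auto simp: a_def)
    have c0: "c \<le> 0" using S(2) c(1) .
    consider "- b < c" | "c = - b" | "c = - (b\<^sup>2 + b + 1)" | "c < - b" "c \<noteq> - (b\<^sup>2 + b + 1)" by linarith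
    then show ?thesis
    proof cases
      case 1
      have "irreducible_cone 2 S a (replicate 3 a @ [c, a])"
      proof (rule cone)
        have "c \<notin> T" "a\<^sup>2 + c \<notin> T" using 1 c0 sqa bb b by (auto simp: T)
        then show "word_value 2 x e \<notin> T" if "[c, a] = x @ e # z" for x e z
          using that by (auto simp: append_Cons_eq_short)
        fix u j
        define n where "n = word_value 2 u j"
        define x where "x = n\<^sup>2 + a"
        show "word_value 2 [c, a] (word_value 2 u j) \<notin> T"
        proof
          assume "word_value 2 [c, a] (word_value 2 u j) \<in> T"
          then have "\<bar>x\<^sup>2 + c\<bar> = b" by (simp add: T n_def x_def)
          then have x2: "x\<^sup>2 \<le> 2 * b - 1" using 1 c0 by linarith
          have "\<bar>x\<bar> < b - 1"
          proof (rule ccontr)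
            assume "\<not> \<bar>x\<bar> < b - 1"
            then have "(b - 1) * (b - 1) \<le> \<bar>x\<bar> * \<bar>x\<bar>" using b by (intro mult_mono) auto
            moreover have "(b - 1) * (b - 1) = b\<^sup>2 - 2 * b + 1" "\<bar>x\<bar> * \<bar>x\<bar> = x\<^sup>2"
              by (simp_all add: power2_eq_square algebra_simps)
            ultimately show False using x2 bb b by linarith
          qed
          moreover have "n\<^sup>2 = b\<^sup>2 - b + x" by (simp add: x_def a_def)
          ultimately show False
            using b by (intro square_between'[of n "b\<^sup>2 - b + x" "b - 1"]) (auto simp: power2_eq_square algebra_simps)
        qed
      qed (use av in auto)
      then show ?thesis using a2(2) c(1) unfolding a_def by (intro bexI) auto
    next
      case 2
      have "irreducible (word_poly 2 [a, a])"
        using irreducible_word_replicate[of 2 a 1] airr a2(1) by simp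
      then have irr: "irreducible (word_poly 2 (a # [a, - b]))"
        using irreducible_second_iterate_append[OF y(2,1) a_def] by simp
      have big: "\<bar>a\<bar> \<le> \<bar>word_value 2 [a, - b] x\<bar>" if "\<bar>a\<bar> \<le> \<bar>x\<bar> \<or> x = b \<or> x = 1 - b" for x
      proof -
        have abs_a: "\<bar>a\<bar> = b\<^sup>2 - b" using bb b by (simp add: a_def)
        have *: "\<bar>a\<bar> \<le> \<bar>z\<^sup>2 + a\<bar>" if "\<bar>a\<bar> \<le> \<bar>z\<bar>" for z
          using abs_orbit_mono[of 2 a z] a2(1) that by simp
        from that show ?thesis
        proof (elim disjE)
          assume x: "\<bar>a\<bar> \<le> \<bar>x\<bar>"
          then have "a\<^sup>2 \<le> x\<^sup>2" by (simp add: abs_le_square_iff)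
          then have "\<bar>a\<bar> \<le> \<bar>x\<^sup>2 - b\<bar>" using sqa bb b unfolding abs_a by linarith
          then show ?thesis using *[of "x\<^sup>2 - b"] by simp
        next
          assume "x = b"
          then show ?thesis using *[of "b\<^sup>2 - b"] abs_a b by simp
        next
          assume x: "x = 1 - b"
          define z where "z = b\<^sup>2 - 3 * b + 1"
          have "z\<^sup>2 = b\<^sup>2 * b\<^sup>2 - 6 * (b * b\<^sup>2) + 11 * b\<^sup>2 - 6 * b + 1"
            by (simp add: z_def power2_eq_square algebra_simps)
          moreover have "0 \<le> (b - 4) * (b - 2) * b\<^sup>2" using b by simp
          then have "0 \<le> b\<^sup>2 * b\<^sup>2 - 6 * (b * b\<^sup>2) + 8 * b\<^sup>2" by (simp add: power2_eq_square algebra_simps)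
          ultimately have "2 * b\<^sup>2 - 2 * b \<le> z\<^sup>2" using bb b by (smt (verit))
          then have "2 * \<bar>a\<bar> \<le> z\<^sup>2" unfolding abs_a by simp
          then have "\<bar>a\<bar> \<le> \<bar>z\<^sup>2 + a\<bar>" by linarith
          moreover have "(1 - b)\<^sup>2 - b = z" by (simp add: z_def power2_eq_square algebra_simps)
          ultimately show ?thesis by (simp add: x)
        qed
      qed
      have "irreducible_cone 2 S a ([a, - b] @ replicate 3 a)"
      proof (rule irreducible_coneI)
        show "irreducible (word_poly 2 (a # [a, - b] @ replicate 3 a))"
        proof (rule irreducible_word_append[OF _ irr])
          fix x e z assume "replicate 3 a = x @ e # z"
          then have "\<bar>a\<bar> \<le> \<bar>word_value 2 x e\<bar>"
            using word_value_prefix_large[of 2 a 3 x e z] a2(1) by simp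
          then have "\<bar>a\<bar> \<le> \<bar>word_value 2 [a, - b] (word_value 2 x e)\<bar>" by (intro big disjI1)
          then show "avoids_powers 2 a (word_value 2 [a, - b] (word_value 2 x e))"
            by (rule avoids_powers_large[OF pos2 a2(1)])
        qed simp
        fix w j
        define t where "t = word_value 2 (replicate 3 a) (word_value 2 w j)"
        have "\<bar>a\<bar> \<le> \<bar>t\<bar> \<or> t = b \<or> t = 1 - b"
        proof (cases "\<bar>a\<bar> \<le> \<bar>t\<bar>")
          case False
          have C: "- (b\<^sup>2 - b) = a" "\<bar>a\<bar> = b\<^sup>2 - b" using bb b by (auto simp: a_def)
          have "(b\<^sup>2 - b = t\<^sup>2 - t \<or> b\<^sup>2 - b = t\<^sup>2 + t + 1)"
            using small_third_word_value_quadratic[of "b\<^sup>2 - b" t "word_value 2 w j"] False a2(1)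
            unfolding C t_def by auto
          moreover have "b\<^sup>2 - b \<noteq> t\<^sup>2 + t + 1"
          proof
            assume "b\<^sup>2 - b = t\<^sup>2 + t + 1"
            moreover have "even (b\<^sup>2 - b)" "odd (t\<^sup>2 + t + 1)" by auto
            ultimately show False by simp
          qed
          ultimately have "(t - b) * (t + b - 1) = 0" by (simp add: power2_eq_square algebra_simps)
          then show ?thesis by auto
        qed simp
        then have "\<bar>a\<bar> \<le> \<bar>word_value 2 [a, - b] t\<bar>" by (rule big)
        then show "avoids_powers 2 a (word_value 2 ([a, - b] @ replicate 3 a) (word_value 2 w j))"
          unfolding word_value_append t_def[symmetric] by (rule avoids_powers_large[OF pos2 a2(1)])
      qed simp
      then show ?thesis using a2(2) c(1) 2 unfolding a_def by (intro bexI) auto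
    next
      case 3
      define w where "w = replicate 3 c @ [a]"
      have c2: "2 \<le> \<bar>c\<bar>" "\<bar>c\<bar> = b\<^sup>2 + b + 1" using 3 b bb by auto
      have "irreducible_cone 2 S a (replicate 3 a @ w)"
      proof (rule cone)
        fix x e z assume split: "w = x @ e # z"
        have "\<bar>c\<bar> \<le> \<bar>word_value 2 x e\<bar>"
        proof (cases z rule: rev_cases)
          case Nil
          then have x: "x = replicate 2 c @ [c]" "e = a" using split by (auto simp: w_def replicate_three numeral_2_eq_2)
          have "\<bar>c\<bar> \<le> \<bar>a\<^sup>2 + c\<bar>" using sqa c2(2) 3 b by linarith
          then have "\<bar>c\<bar> \<le> \<bar>word_value 2 (replicate 2 c) (a\<^sup>2 + c)\<bar>"
            by (intro word_value_replicate_large c2) simp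
          then show ?thesis unfolding x word_value_append by simp
        next
          case (snoc z' e')
          then have "replicate 3 c = x @ e # z'" using split by (simp add: w_def)
          then show ?thesis using word_value_prefix_large[of 2 c 3 x e z'] c2(1) by simp
        qed
        then show "word_value 2 x e \<notin> T" using c2 bb b by (auto simp: T)
      next
        fix u j
        define n where "n = word_value 2 u j"
        define t where "t = word_value 2 (replicate 3 c) (n\<^sup>2 + a)"
        have "t \<notin> T"
        proof
          assume "t \<in> T"
          then have t: "t = b \<or> t = - b" by (simp add: T')
          have cC: "- (b\<^sup>2 + b + 1) = c" using 3 by simp
          have "b\<^sup>2 + b + 1 = t\<^sup>2 - t \<or> (b\<^sup>2 + b + 1 = t\<^sup>2 + t + 1 \<and> (n\<^sup>2 + a)\<^sup>2 = (t + 1)\<^sup>2)"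
            using small_third_word_value_quadratic[of "b\<^sup>2 + b + 1" t "n\<^sup>2 + a"] t b bb
            unfolding cC t_def[symmetric] by auto
          then have "(n\<^sup>2 + a)\<^sup>2 = (b + 1)\<^sup>2" using t b by auto
          then have "n\<^sup>2 = b\<^sup>2 + 1 \<or> n\<^sup>2 = b\<^sup>2 - 2 * b - 1" by (auto simp: power2_eq_iff a_def)
          then show False
            using square_between[of b "b\<^sup>2 + 1" n] square_between[of "b - 2" "b\<^sup>2 - 2 * b - 1" n] b
            by (auto simp: power2_eq_square algebra_simps)
        qed
        then show "word_value 2 w (word_value 2 u j) \<notin> T"
          by (simp add: w_def t_def n_def word_value_append)
      qed (use av in auto)
      then show ?thesis using a2(2) c(1) unfolding a_def w_def by (intro bexI) auto
    next
      case 4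
      have c2: "2 \<le> \<bar>c\<bar>" "b < \<bar>c\<bar>" using 4 b by auto
      have "irreducible_cone 2 S a (replicate 3 a @ replicate 3 c)"
      proof (rule cone)
        show "word_value 2 x e \<notin> T" if "replicate 3 c = x @ e # z" for x e z
          using word_value_prefix_large[OF _ c2(1) that, of 2] c2(2) by (auto simp: T)
        fix u j
        define t where "t = word_value 2 (replicate 3 c) (word_value 2 u j)"
        have "t \<notin> T"
        proof
          assume "t \<in> T"
          then have t: "t = b \<or> t = - b" by (simp add: T')
          have "- c = t\<^sup>2 - t \<or> - c = t\<^sup>2 + t + 1"
            using small_third_word_value_quadratic[of "- c" t "word_value 2 u j"] t 4 b t_def by auto
          then show False using t c(2-4) 4(2) unfolding a_def by auto
        qed
        then show "word_value 2 (replicate 3 c) (word_value 2 u j) \<notin> T" by (simp add: t_def)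
      qed (use av in auto)
      then show ?thesis using a2(2) c(1) unfolding a_def by (intro bexI) auto
    qed
  qed
qed

text \<open>
  As for fixed points: the set of all \<open>\<plusminus>e\<close> and \<open>\<plusminus>(e + 1)\<close> contains its own preimages under both
  generators. For \<open>e = 1\<close> and the constant \<open>- 2\<close> this fails, as \<open>0\<close> is mapped to \<open>- 2\<close>.
\<close>

lemma irreducible_cone_square_two_cycle_closed:
  assumes a: "irreducible (binomial_poly 2 a)" "a = - (e\<^sup>2 + e + 1)" and e: "1 \<le> e"
    and avoid: "\<And>n. n\<^sup>2 \<noteq> e\<^sup>2 \<Longrightarrow> avoids_powers 2 a (word_value 2 (replicate 3 a) n)"
    and S: "S \<subseteq> {a, - (e\<^sup>2 + e)}" "e = 1 \<Longrightarrow> - 2 \<notin> S"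
  shows "irreducible_cone 2 S a (replicate 3 a @ [])"
proof (rule irreducible_cone_avoiding[where T = "{n. n\<^sup>2 = e\<^sup>2}"])
  define Z where "Z = {n. n\<^sup>2 = e\<^sup>2 \<or> n\<^sup>2 = (e + 1)\<^sup>2}"
  have abs: "n \<in> Z \<longleftrightarrow> n = e \<or> n = - e \<or> n = e + 1 \<or> n = - (e + 1)" for n
    by (auto simp: Z_def power2_eq_iff)
  have ee: "e \<le> e\<^sup>2" using e by (simp add: power2_eq_square)
  have e2: "e \<noteq> 1 \<Longrightarrow> 2 * e \<le> e\<^sup>2" using e by (simp add: power2_eq_square)
  have sq: "x\<^sup>2 \<noteq> e\<^sup>2 + 1" "x\<^sup>2 \<noteq> e\<^sup>2 + 2 * e + 2" "x\<^sup>2 \<noteq> e\<^sup>2 + 2 * e" "e \<noteq> 1 \<Longrightarrow> x\<^sup>2 \<noteq> e\<^sup>2 - 1" for x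
    using e square_between[of e "e\<^sup>2 + 1" x] square_between[of "e + 1" "e\<^sup>2 + 2 * e + 2" x]
      square_between[of e "e\<^sup>2 + 2 * e" x] square_between[of "e - 1" "e\<^sup>2 - 1" x]
    by (auto simp: power2_eq_square algebra_simps)
  have Z': "x\<^sup>2 = e\<^sup>2 \<or> x\<^sup>2 = e\<^sup>2 + 2 * e + 1 \<Longrightarrow> x \<in> Z" for x
    by (auto simp: Z_def power2_eq_square algebra_simps)
  fix u j assume uj: "u \<in> lists S" "j \<in> S"
  have "word_value 2 u j \<notin> Z"
  proof (rule words_avoid_closed_set[OF _ _ uj])
    fix j assume j: "j \<in> S"
    then have "j = a \<or> (j = - (e\<^sup>2 + e) \<and> e \<noteq> 1)" using S by auto
    then show "j \<notin> Z" using ee e2 e by (auto simp: abs a(2))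
  next
    fix c x assume c: "c \<in> S" and x: "x\<^sup>2 + c \<in> Z"
    have "x\<^sup>2 = e - c \<or> x\<^sup>2 = - e - c \<or> x\<^sup>2 = e + 1 - c \<or> x\<^sup>2 = - (e + 1) - c"
      using x by (auto simp: abs)
    moreover have "c = a \<or> (c = - (e\<^sup>2 + e) \<and> e \<noteq> 1)" using c S by auto
    ultimately show "x \<in> Z" using sq[of x] Z'[of x] by (elim disjE) (auto simp: a(2))
  qed
  then show "word_value 2 [] (word_value 2 u j) \<notin> {n. n\<^sup>2 = e\<^sup>2}" by (simp add: Z_def)
next
  show "2 \<le> \<bar>a\<bar>" using e zero_le_power2[of e] unfolding a(2) by linarith
qed (use a avoid in auto)

text \<open>
  The map \<open>x ^ 2 + a\<close> exchanges \<open>\<plusminus>e\<close> and \<open>\<plusminus>(e + 1)\<close> up to sign, so there is a choice: after three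
  letters \<open>a\<close> the integers \<open>\<plusminus>e\<close> are dangerous, after four letters \<open>a\<close> instead \<open>\<plusminus>(e + 1)\<close>. For every
  further constant at least one of the two pairs can be avoided.
\<close>

lemma irreducible_cone_square_two_cycle:
  assumes a: "irreducible (binomial_poly 2 a)" "a = - (e\<^sup>2 + e + 1)" and y: "e = y\<^sup>2" "1 \<le> y"
    and avoid: "\<And>n. n\<^sup>2 \<noteq> e\<^sup>2 \<Longrightarrow> avoids_powers 2 a (word_value 2 (replicate 3 a) n)"
    and S: "a \<in> S" "\<And>c. c \<in> S \<Longrightarrow> c \<le> 0" "e = 1 \<Longrightarrow> - 2 \<notin> S"
  shows "\<exists>v\<in>lists S. irreducible_cone 2 S a v"
proof -
  have e: "e = 1 \<or> 4 \<le> e"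
  proof (cases "y = 1")
    case False
    then show ?thesis using y power_mono[of 2 y 2] by simp
  qed (use y in simp)
  then have e1: "1 \<le> e" by auto
  then have ee: "e \<le> e\<^sup>2" by (simp add: power2_eq_square)
  have a2: "2 \<le> \<bar>a\<bar>" using e1 ee by (simp add: a(2))
  have avoid4: "avoids_powers 2 a (word_value 2 (replicate 4 a) n)" if n: "n\<^sup>2 \<noteq> (e + 1)\<^sup>2" for n
  proof -
    have "(n\<^sup>2 + a)\<^sup>2 \<noteq> e\<^sup>2"
    proof
      assume "(n\<^sup>2 + a)\<^sup>2 = e\<^sup>2"
      then have "n\<^sup>2 + a = e \<or> n\<^sup>2 + a = - e" by (simp add: power2_eq_iff)
      then have "n\<^sup>2 = (e + 1)\<^sup>2 \<or> n\<^sup>2 = e\<^sup>2 + 1" by (auto simp: a(2) power2_eq_square algebra_simps)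
      then show False using n square_between[of e "e\<^sup>2 + 1" n] e1 by (auto simp: power2_eq_square algebra_simps)
    qed
    moreover have "replicate 4 a = replicate 3 a @ [a]" by (simp add: numeral_eq_Suc)
    ultimately show ?thesis using avoid by (simp add: word_value_append)
  qed
  note cone = irreducible_cone_avoiding[where S = S and d = 2 and a = a, OF _ a(1) a2]
  show ?thesis
  proof (cases "S \<subseteq> {a, - (e\<^sup>2 + e)}")
    case True
    then have "irreducible_cone 2 S a (replicate 3 a @ [])"
      using irreducible_cone_square_two_cycle_closed[OF a e1 avoid] S(3) by blast
    then show ?thesis using S(1) by (intro bexI) auto
  next
    case False
    then obtain c where c: "c \<in> S" "c \<noteq> a" "c \<noteq> - (e\<^sup>2 + e)" by auto
    have c0: "c \<le> 0" using S(2) c(1) .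
    show ?thesis
    proof (cases "- (e + 1) \<le> c")
      case True
      have miss: "\<bar>(n\<^sup>2 + a)\<^sup>2 + c\<bar> \<noteq> f" if f: "(f = e + 1 \<and> - e \<le> c) \<or> (f = e \<and> 4 \<le> e)" for n f
      proof
        define x where "x = n\<^sup>2 + a"
        assume *: "\<bar>(n\<^sup>2 + a)\<^sup>2 + c\<bar> = f"
        then have x2: "x\<^sup>2 \<le> 2 * e + 1" using f c0 True unfolding x_def by linarith
        have "4 \<le> e"
        proof (rule ccontr)
          assume "\<not> 4 \<le> e"
          then have "e = 1" "f = 2" "c = 0 \<or> c = - 1" using e f c0 by auto
          moreover from this have "x\<^sup>2 = 2 - c" using * zero_le_power2[of x] unfolding x_def by linarith
          ultimately show False using square_between[of 1 2 x] square_between[of 1 3 x] by auto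
        qed
        then have "\<bar>x\<bar> < e" using abs_less_if_square_le x2 by blast
        moreover have "n\<^sup>2 = e\<^sup>2 + e + 1 + x" by (simp add: x_def a(2))
        ultimately show False
          using e1 by (intro square_between'[of n "e\<^sup>2 + e + 1 + x" e]) (auto simp: power2_eq_square algebra_simps)
      qed
      have big: "e + 1 < a\<^sup>2 + c"
      proof -
        have "a\<^sup>2 = (e\<^sup>2 + e + 1)\<^sup>2" unfolding a(2) by (rule power2_minus)
        moreover have "(2 * e + 1)\<^sup>2 \<le> (e\<^sup>2 + e + 1)\<^sup>2" using ee e1 by (intro power_mono) auto
        moreover have "(2 * e + 1)\<^sup>2 = 4 * e\<^sup>2 + 4 * e + 1" by (simp add: power2_eq_square algebra_simps)
        ultimately show ?thesis using True ee e1 by linarith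
      qed
      \<comment> \<open>\<open>f\<close> is the dangerous integer up to sign after \<open>k\<close> letters \<open>a\<close>\<close>
      obtain f k where fk: "(f = e + 1 \<and> - e \<le> c \<and> k = 4) \<or> (f = e \<and> 4 \<le> e \<and> c = - (e + 1) \<and> k = (3::nat))"
      proof (cases "c = - (e + 1)")
        case True
        then have "e \<noteq> 1" using c(3) by auto
        then show ?thesis using that True e by blast
      next
        case False
        then show ?thesis using that \<open>- (e + 1) \<le> c\<close> by force
      qed
      have "irreducible_cone 2 S a (replicate k a @ [c, a])"
      proof (rule cone[where T = "{n. n\<^sup>2 = f\<^sup>2}"])
        show "avoids_powers 2 a (word_value 2 (replicate k a) n)" if "n \<notin> {n. n\<^sup>2 = f\<^sup>2}" for n
          using that fk avoid avoid4 by auto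
        have "c \<noteq> f" "c \<noteq> - f" "a\<^sup>2 + c \<noteq> f" "a\<^sup>2 + c \<noteq> - f" using fk c0 big e1 by auto
        then show "word_value 2 x g \<notin> {n. n\<^sup>2 = f\<^sup>2}" if "[c, a] = x @ g # z" for x g z
          using that by (auto simp: append_Cons_eq_short power2_eq_iff)
        fix u j
        have "\<bar>((word_value 2 u j)\<^sup>2 + a)\<^sup>2 + c\<bar> \<noteq> f" using fk by (intro miss) auto
        moreover have "0 \<le> f" using fk e1 by auto
        ultimately show "word_value 2 [c, a] (word_value 2 u j) \<notin> {n. n\<^sup>2 = f\<^sup>2}"
          by (auto simp: power2_eq_iff)
      qed simp
      then show ?thesis using S(1) c(1) by (intro bexI) auto
    next
      case False
      then have c2: "2 \<le> \<bar>c\<bar>" "e + 1 < - c" using e1 by auto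
      obtain f k where fk: "(f = e \<and> - c \<noteq> e\<^sup>2 - e \<and> - c \<noteq> e\<^sup>2 - e + 1 \<and> k = 3) \<or>
          (f = e + 1 \<and> (- c = e\<^sup>2 - e \<or> - c = e\<^sup>2 - e + 1) \<and> k = (4::nat))"
        by blast
      have "irreducible_cone 2 S a (replicate k a @ replicate 3 c)"
      proof (rule cone[where T = "{n. n\<^sup>2 = f\<^sup>2}"])
        show "avoids_powers 2 a (word_value 2 (replicate k a) n)" if "n \<notin> {n. n\<^sup>2 = f\<^sup>2}" for n
          using that fk avoid avoid4 by auto
        have f: "0 \<le> f" "f < \<bar>c\<bar>" using fk c2 e1 by auto
        show "word_value 2 x g \<notin> {n. n\<^sup>2 = f\<^sup>2}" if "replicate 3 c = x @ g # z" for x g z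
          using word_value_prefix_large[OF _ c2(1) that, of 2] f by (auto simp: power2_eq_iff)
        fix u j
        define t where "t = word_value 2 (replicate 3 c) (word_value 2 u j)"
        have "t\<^sup>2 \<noteq> f\<^sup>2"
        proof
          assume "t\<^sup>2 = f\<^sup>2"
          then have t: "t = f \<or> t = - f" by (simp add: power2_eq_iff)
          have "\<bar>t\<bar> < - c" "2 \<le> - c" using t f c2 e1 by auto
          then have "- c = t\<^sup>2 - t \<or> - c = t\<^sup>2 + t + 1"
            using small_third_word_value_quadratic[of "- c" t "word_value 2 u j"] unfolding t_def by auto
          moreover have "- c \<noteq> e\<^sup>2 + e" "- c \<noteq> e\<^sup>2 + e + 1" using c by (auto simp: a(2))
          ultimately show False using t fk e1 ee
            by (elim disjE conjE) (auto simp: power2_eq_square algebra_simps)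
        qed
        then show "word_value 2 (replicate 3 c) (word_value 2 u j) \<notin> {n. n\<^sup>2 = f\<^sup>2}" by (simp add: t_def)
      qed simp
      then show ?thesis using S(1) c(1) by (intro bexI) auto
    qed
  qed
qed

lemma square_fixed_point_unique:
  fixes b c :: int
  assumes "b\<^sup>2 - b = c\<^sup>2 - c" "2 \<le> b" "0 \<le> c"
  shows "c = b"
proof -
  have "(b - c) * (b + c - 1) = 0" using assms(1) by (simp add: power2_eq_square algebra_simps)
  then show ?thesis using assms(2,3) by auto
qed

lemma square_two_cycle_unique:
  fixes b c :: int
  assumes "b\<^sup>2 + b = c\<^sup>2 + c" "0 \<le> b" "0 \<le> c"
  shows "c = b"
proof -
  have "(b - c) * (b + c + 1) = 0" using assms(1) by (simp add: power2_eq_square algebra_simps)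
  then show ?thesis using assms(2,3) by auto
qed

lemma fixed_point_not_two_cycle: "b\<^sup>2 - b \<noteq> e\<^sup>2 + e + (1::int)"
proof
  assume "b\<^sup>2 - b = e\<^sup>2 + e + 1"
  moreover have "even (b\<^sup>2 - b)" "odd (e\<^sup>2 + e + 1)" by auto
  ultimately show False by simp
qed

text \<open>
  A positive constant settles the matter at once. Otherwise the base letter is kept, except when
  \<open>a = - 3\<close> and \<open>- 2\<close> is available: there \<open>- 2\<close> is the better base letter, as none of the values of
  \<open>x ^ 2 - 2\<close> at its fixed points is a square.
\<close>

lemma irreducible_cone_quadratic:
  assumes a: "a \<in> S" "irreducible (binomial_poly 2 a)"
  shows "\<exists>a\<in>S. \<exists>v\<in>lists S. irreducible_cone 2 S a v"
proof (cases "\<exists>c\<in>S. 0 < c")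
  case True
  then obtain c where c: "c \<in> S" "0 < c" by blast
  have "irreducible (binomial_poly 2 c)"
    by (rule irreducible_binomial_2) (use c in \<open>smt (verit) zero_le_power2\<close>)
  then have "irreducible_cone 2 S c [c]" using c by (intro irreducible_cone_positive) auto
  then show ?thesis using c by (intro bexI) auto
next
  case False
  then have neg: "c \<le> 0" if "c \<in> S" for c using that by (meson not_le)
  define C where "C = - a"
  have C: "2 \<le> C" "a = - C"
    using irreducible_binomial_constant[of 2 a] a neg[OF a(1)] by (auto simp: C_def)
  have airr: "irreducible (binomial_poly 2 (- C))" using a(2) C(2) by simp
  have plain: "\<exists>a\<in>S. \<exists>v\<in>lists S. irreducible_cone 2 S a v"
    if D: "- D \<in> S" "irreducible (binomial_poly 2 (- D))" "2 \<le> D"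
      "\<And>y. D \<noteq> (y\<^sup>2)\<^sup>2 - y\<^sup>2" "\<And>y. D \<noteq> (y\<^sup>2)\<^sup>2 + y\<^sup>2 + 1" for D
  proof -
    have "irreducible_cone 2 S (- D) (replicate 3 (- D) @ [])"
      by (rule irreducible_cone_avoiding[where T = "{}"])
        (use D third_iterate_avoids_squares[of D] in auto)
    then show ?thesis using D(1) by (intro bexI) auto
  qed
  consider (fixed) y where "C = (y\<^sup>2)\<^sup>2 - y\<^sup>2" | (cycle) y where "C = (y\<^sup>2)\<^sup>2 + y\<^sup>2 + 1"
    | (none) "\<And>y. C \<noteq> (y\<^sup>2)\<^sup>2 - y\<^sup>2" "\<And>y. C \<noteq> (y\<^sup>2)\<^sup>2 + y\<^sup>2 + 1" by blast
  then show ?thesis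
  proof cases
    case none
    then show ?thesis using plain[of C] a C by simp
  next
    case (fixed y)
    define b where "b = y\<^sup>2"
    have y2: "2 \<le> \<bar>y\<bar>"
    proof (rule ccontr)
      assume "\<not> 2 \<le> \<bar>y\<bar>"
      then have "y = 0 \<or> y = 1 \<or> y = -1" by auto
      then show False using fixed C(1) by auto
    qed
    then have b2: "2 \<le> b" using power_mono[of 2 "\<bar>y\<bar>" 2] by (simp add: b_def)
    have Cb: "C = b\<^sup>2 - b" "- C = b - b\<^sup>2" using fixed by (simp_all add: b_def)
    have "avoids_powers 2 (- C) (word_value 2 (replicate 3 (- C)) n)" if "n\<^sup>2 \<noteq> b\<^sup>2" for n
    proof (rule third_iterate_avoids_squares[OF C(1)])
      fix x assume "C = (x\<^sup>2)\<^sup>2 - x\<^sup>2"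
      then have "x\<^sup>2 = b" using square_fixed_point_unique[of b "x\<^sup>2"] Cb b2 by simp
      then show "n\<^sup>2 \<noteq> (x\<^sup>2)\<^sup>2" using that by simp
    next
      fix x assume "C = (x\<^sup>2)\<^sup>2 + x\<^sup>2 + 1"
      then show "n\<^sup>2 \<noteq> (x\<^sup>2)\<^sup>2" using Cb fixed_point_not_two_cycle by metis
    qed
    then have "\<exists>v\<in>lists S. irreducible_cone 2 S (b - b\<^sup>2) v"
      using irreducible_cone_square_fixed_point[of b "\<bar>y\<bar>" S] airr a(1) C(2) neg y2
      unfolding Cb(2) by (simp add: b_def)
    then show ?thesis using a(1) C(2) Cb by (intro bexI[of _ "b - b\<^sup>2"]) auto
  next
    case (cycle y)
    define e where "e = y\<^sup>2"
    have y1: "1 \<le> \<bar>y\<bar>" using cycle C(1) by (cases "y = 0") auto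
    then have e1: "1 \<le> e" using power_mono[of 1 "\<bar>y\<bar>" 2] by (simp add: e_def)
    have Ce: "C = e\<^sup>2 + e + 1" using cycle by (simp add: e_def)
    show ?thesis
    proof (cases "e = 1 \<and> - 2 \<in> S")
      case True
      have "irreducible (binomial_poly 2 (- 2))"
      proof (rule irreducible_binomial_2)
        show "r\<^sup>2 + - 2 \<noteq> 0" for r :: int using square_between[of 1 2 r] by auto
      qed
      moreover have "2 \<noteq> (x\<^sup>2)\<^sup>2 - x\<^sup>2" for x :: int
      proof
        assume "2 = (x\<^sup>2)\<^sup>2 - x\<^sup>2"
        then have "x\<^sup>2 = 2" using square_fixed_point_unique[of 2 "x\<^sup>2"] by simp
        then show False using square_between[of 1 2 x] by simp
      qed
      moreover have "2 \<noteq> (x\<^sup>2)\<^sup>2 + x\<^sup>2 + 1" for x :: int using fixed_point_not_two_cycle[of 2 "x\<^sup>2"] by simp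
      ultimately show ?thesis using plain[of 2] True by simp
    next
      case False
      have "avoids_powers 2 (- C) (word_value 2 (replicate 3 (- C)) n)" if "n\<^sup>2 \<noteq> e\<^sup>2" for n
      proof (rule third_iterate_avoids_squares[OF C(1)])
        fix x assume "C = (x\<^sup>2)\<^sup>2 - x\<^sup>2"
        then show "n\<^sup>2 \<noteq> (x\<^sup>2)\<^sup>2" using Ce fixed_point_not_two_cycle by metis
      next
        fix x assume "C = (x\<^sup>2)\<^sup>2 + x\<^sup>2 + 1"
        then have "x\<^sup>2 = e" using square_two_cycle_unique[of e "x\<^sup>2"] Ce e1 by simp
        then show "n\<^sup>2 \<noteq> (x\<^sup>2)\<^sup>2" using that by simp
      qed
      then have "\<exists>v\<in>lists S. irreducible_cone 2 S (- C) v"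
        using irreducible_cone_square_two_cycle[of "- C" e "\<bar>y\<bar>" S] airr a(1) C(2) neg y1 False Ce
        by (simp add: e_def)
      then show ?thesis using a(1) C(2) by (intro bexI[of _ "- C"]) auto
    qed
  qed
qed

section \<open>The exceptional pair of cubic generators\<close>

lemma decompose_mod_three:
  fixes g :: "rat poly"
  shows "\<exists>g0 g1 g2. g = pcompose g0 (monom 1 3) + [:0, 1:] * pcompose g1 (monom 1 3)
           + [:0, 1:]\<^sup>2 * pcompose g2 (monom 1 3)"
proof (induction g)
  case 0
  show ?case by (intro exI[of _ 0]) simp
next
  case (pCons c g)
  then obtain g0 g1 g2 where g: "g = pcompose g0 (monom 1 3) + [:0, 1:] * pcompose g1 (monom 1 3)
      + [:0, 1:]\<^sup>2 * pcompose g2 (monom 1 3)" by blast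
  define X :: "rat poly" where "X = [:0, 1:]"
  have m: "monom (1::rat) 3 = X ^ 3" by (simp add: X_def monom_altdef)
  have "pCons c g = [:c:] + X * g" by (simp add: X_def)
  also have "\<dots> = pcompose (pCons c g2) (monom 1 3) + X * pcompose g0 (monom 1 3) + X\<^sup>2 * pcompose g1 (monom 1 3)"
    unfolding g X_def[symmetric] m pcompose_pCons
    by (simp add: algebra_simps power2_eq_square power3_eq_cube)
  finally show ?case unfolding X_def by blast
qed

text \<open>
  Capelli's theorem for the exponent three, in the stronger form that a root of \<open>h\<close> is a cube in the
  field it generates. Write a proper factor \<open>g\<close> of \<open>h(x ^ 3)\<close> by exponents modulo three. At a root
  \<open>y\<close> of \<open>g\<close> with \<open>x = y ^ 3\<close>, this gives a quadratic equation for \<open>y\<close> over the field of \<open>x\<close>;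
  together with \<open>y ^ 3 = x\<close> it either determines \<open>y\<close> rationally in \<open>x\<close>, or it is so degenerate that
  the ratio of two of its coefficients is a cube root of \<open>x\<close>.
\<close>

lemma cube_root_in_root_field:
  fixes h :: "rat poly"
  assumes h: "irreducible h" and red: "\<not> irreducible (pcompose h (monom 1 3))"
  shows "\<exists>r. h dvd r ^ 3 - [:0, 1:]"
proof -
  have dh: "degree h > 0" using h
    by (metis irreducible_def is_unit_iff_degree not_gr_zero)
  obtain g where g: "g dvd pcompose h (monom 1 3)" "0 < degree g" "degree g < degree h * 3"
    using monic_factor_if_reducible[OF red] dh by auto
  obtain g0 g1 g2 where dec: "g = pcompose g0 (monom 1 3) + [:0, 1:] * pcompose g1 (monom 1 3)
      + [:0, 1:]\<^sup>2 * pcompose g2 (monom 1 3)" using decompose_mod_three by blast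
  obtain y where y: "poly (cpx g) y = 0"
    using g(2) by (metis degree_cpx constant_degree fundamental_theorem_of_algebra not_gr_zero)
  define x where "x = y ^ 3"
  have "poly (cpx (pcompose h (monom 1 3))) y = 0"
    using g(1) y by (metis cpx_simps(3) dvdE mult_zero_left poly_mult)
  then have hx: "poly (cpx h) x = 0" by (simp add: poly_pcompose map_poly_monom poly_monom x_def)
  have dvd_iff: "h dvd q \<longleftrightarrow> poly (cpx q) x = 0" for q
    using irreducible_dvd_if_common_complex_root[OF h hx, of q] hx
    by (metis cpx_simps(3) dvdE mult_zero_left poly_mult)
  have solve: "\<exists>r. h dvd r ^ 3 - [:0, 1:]"
    if u: "poly (cpx u) x \<noteq> 0" and v: "poly (cpx v) x ^ 3 = x * poly (cpx u) x ^ 3" for u v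
  proof -
    obtain s t where "s * h + t * u = 1"
      using bezout_irreducible[OF h, of u] u dvd_iff by blast
    then have "cpx s * cpx h + cpx t * cpx u = 1" by (metis cpx_simps(1,3,5))
    then have "poly (cpx s * cpx h + cpx t * cpx u) x = 1" by simp
    then have tu: "poly (cpx t) x * poly (cpx u) x = 1" using hx by simp
    have "poly (cpx ((t * v) ^ 3 - [:0, 1:])) x = poly (cpx t) x ^ 3 * poly (cpx v) x ^ 3 - x"
      by (simp add: power_mult_distrib)
    also have "\<dots> = x * (poly (cpx t) x * poly (cpx u) x) ^ 3 - x"
      by (simp add: v power_mult_distrib)
    finally have "poly (cpx ((t * v) ^ 3 - [:0, 1:])) x = 0" using tu by simp
    then show ?thesis unfolding dvd_iff by blast
  qed
  let ?a = "poly (cpx g0) x" and ?b = "poly (cpx g1) x" and ?c = "poly (cpx g2) x"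
  have eq1: "?a + y * ?b + y\<^sup>2 * ?c = 0"
    using y unfolding dec by (simp add: poly_pcompose map_poly_monom poly_monom x_def power2_eq_square mult.assoc)
  have eq2: "y * (?b\<^sup>2 - ?a * ?c) = x * ?c\<^sup>2 - ?a * ?b"
  proof -
    have "y * (?b\<^sup>2 - ?a * ?c) - (x * ?c\<^sup>2 - ?a * ?b)
        = ?b * (?a + y * ?b + y\<^sup>2 * ?c) - y * ?c * (?a + y * ?b + y\<^sup>2 * ?c)"
      by (simp add: x_def algebra_simps power2_eq_square power3_eq_cube)
    then show ?thesis using eq1 by simp
  qed
  show ?thesis
  proof (cases "?b\<^sup>2 - ?a * ?c = 0")
    case False
    have "(y * (?b\<^sup>2 - ?a * ?c)) ^ 3 = x * (?b\<^sup>2 - ?a * ?c) ^ 3"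
      by (simp add: power_mult_distrib x_def)
    then have v: "(x * ?c\<^sup>2 - ?a * ?b) ^ 3 = x * (?b\<^sup>2 - ?a * ?c) ^ 3" by (simp only: eq2)
    show ?thesis
      by (rule solve[of "g1\<^sup>2 - g0 * g2" "[:0, 1:] * g2\<^sup>2 - g0 * g1"]) (use False v in simp_all)
  next
    case True
    then have e: "?b\<^sup>2 = ?a * ?c" "x * ?c\<^sup>2 = ?a * ?b" using eq2 by auto
    show ?thesis
    proof (cases "?c = 0")
      case False
      have "?b ^ 3 = ?a * ?b * ?c" using e(1) by (simp add: power3_eq_cube power2_eq_square)
      also have "\<dots> = x * ?c ^ 3" using e(2) by (simp add: power3_eq_cube power2_eq_square mult.assoc)
      finally show ?thesis using solve[of g2 g1] False by blast
    next
      case True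
      then have "?b = 0" "?a = 0" using e eq1 by auto
      then have "h dvd g0" "h dvd g1" "h dvd g2" using True dvd_iff by auto
      then have "pcompose h (monom 1 3) dvd pcompose g0 (monom 1 3)"
        "pcompose h (monom 1 3) dvd pcompose g1 (monom 1 3)"
        "pcompose h (monom 1 3) dvd pcompose g2 (monom 1 3)"
        by (auto elim!: dvdE simp: pcompose_mult)
      then have "pcompose h (monom 1 3) dvd g"
        unfolding dec by (intro dvd_add dvd_mult)
      then have "degree (pcompose h (monom 1 3)) \<le> degree g"
        using g(2) by (intro dvd_imp_degree_le) auto
      then show ?thesis using g(3) by simp
    qed
  qed
qed

lemma common_denominator:
  fixes r :: "rat poly"
  shows "\<exists>M::int. M \<noteq> 0 \<and> (\<forall>z::int. \<exists>y::int. of_int M * poly r (of_int z) = of_int y)"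
proof (induction r)
  case 0
  show ?case by (intro exI[of _ 1]) (auto intro: exI[of _ 0])
next
  case (pCons c r)
  then obtain M where M: "M \<noteq> 0" "\<And>z::int. \<exists>y::int. of_int M * poly r (of_int z) = of_int y" by blast
  obtain k l where q: "quotient_of c = (k, l)" by force
  have c: "c = of_int k / of_int l" "l > 0"
    using quotient_of_div[OF q] quotient_of_denom_pos[OF q] by auto
  have "\<exists>y::int. of_int (l * M) * poly (pCons c r) (of_int z) = of_int y" for z
  proof -
    obtain y where y: "of_int M * poly r (of_int z) = (of_int y :: rat)" using M(2) by blast
    have "of_int (l * M) * poly (pCons c r) (of_int z)
        = of_int M * (of_int l * c) + of_int l * of_int z * (of_int M * poly r (of_int z))"
      by (simp add: algebra_simps)
    also have "of_int l * c = of_int k" using c by simp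
    finally show ?thesis unfolding y by (metis of_int_add of_int_mult)
  qed
  then show ?case using M(1) c(2) by (intro exI[of _ "l * M"]) auto
qed

lemma solve_linear_mod_prime:
  fixes q m s :: int
  assumes "prime q" "\<not> q dvd m"
  shows "\<exists>y. q dvd s + m * y"
proof -
  have "coprime m q" using assms by (metis coprime_commute prime_imp_coprime)
  then obtain u v where "u * m + v * q = 1"
    by (metis bezout_int coprime_imp_gcd_eq_1)
  then have "s + m * (- s * u) = q * (s * v)"
    by (metis (no_types, opaque_lifting) add_diff_cancel_left' diff_minus_eq_add mult.commute mult.left_commute mult_minus_right right_diff_distrib' mult.right_neutral minus_mult_left add_uminus_conv_diff)
  then show ?thesis by (metis dvd_triv_left)
qed

text \<open>
  Newton iteration from \<open>1\<close>. For \<open>q = 3\<close> the derivative \<open>3 * x ^ 2\<close> is divisible by \<open>q\<close>, which costs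
  one power of \<open>q\<close> in the distance of the root from \<open>1\<close>; the bound \<open>A \<ge> 2\<close> makes this affordable.
\<close>

lemma cube_root_mod_prime_power:
  fixes q a :: int
  assumes q: "prime q" and A: "A \<ge> 2" and a: "q ^ A dvd a - 1"
  shows "\<exists>x. q ^ N dvd x ^ 3 - a \<and> q ^ (A - 1) dvd x - 1"
proof -
  have "\<exists>x. q ^ (A + i) dvd x ^ 3 - a \<and> q ^ (A - 1) dvd x - 1" for i
  proof (induction i)
    case 0
    show ?case using a by (intro exI[of _ 1]) (simp add: dvd_diff_commute)
  next
    case (Suc i)
    then obtain x s where x: "x ^ 3 - a = q ^ (A + i) * s" "q ^ (A - 1) dvd x - 1" by (auto elim!: dvdE)
    have "q ^ 1 dvd q ^ (A - 1)" using A by (intro le_imp_power_dvd) auto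
    then have qx1: "q dvd x - 1" using x(2) by (metis dvd_trans power_one_right)
    have qx: "\<not> q dvd x"
    proof
      assume "q dvd x"
      then have "q dvd x - (x - 1)" using qx1 by (rule dvd_diff)
      then show False using q by (simp add: not_prime_unit)
    qed
    show ?case
    proof (cases "q = 3")
      case False
      have "\<not> q dvd 3" using False q primes_dvd_imp_eq[of q 3] by (auto simp: prime_int_numeral_eq)
      then have "\<not> q dvd 3 * x\<^sup>2" using qx q by (metis prime_dvd_mult_iff prime_dvd_power)
      then obtain y where y: "q dvd s + 3 * x\<^sup>2 * y" using solve_linear_mod_prime[OF q] by blast
      define h where "h = q ^ (A + i) * y"
      have "(x + h) ^ 3 - a = q ^ (A + i) * (s + 3 * x\<^sup>2 * y) + h * h * (3 * x + h)"
        using x(1) by (simp add: h_def power3_eq_cube power2_eq_square algebra_simps)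
      moreover have "q ^ (A + i) * q dvd q ^ (A + i) * (s + 3 * x\<^sup>2 * y)"
        using y by (intro mult_dvd_mono) auto
      moreover have "q ^ (A + i) * q dvd h * h"
        unfolding h_def using A by (intro mult_dvd_mono dvd_mult2) (auto intro: dvd_power)
      ultimately have "q ^ (A + Suc i) dvd (x + h) ^ 3 - a"
        by (simp add: mult.commute dvd_add dvd_mult)
      moreover have "q ^ (A - 1) dvd h" unfolding h_def
        by (intro dvd_mult2 le_imp_power_dvd) auto
      then have "q ^ (A - 1) dvd (x + h) - 1" using x(2) by (metis add_diff_eq diff_add_eq dvd_add)
      ultimately show ?thesis by blast
    next
      case True
      have "\<not> q dvd x\<^sup>2" using qx q prime_dvd_power by blast
      then obtain y where y: "q dvd s + x\<^sup>2 * y" using solve_linear_mod_prime[OF q] by blast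
      obtain e where e: "A + i = e + 2" using A by (metis add.commute le_Suc_ex trans_le_add1)
      define h where "h = 3 ^ (e + 1) * y"
      have "(x + h) ^ 3 - a = 3 ^ (e + 2) * (s + x\<^sup>2 * y) + 3 ^ (e + 3) * (3 ^ e * y * y * x + 3 ^ (2 * e) * y * y * y)"
        using x(1) unfolding True e
        by (simp add: h_def power3_eq_cube power2_eq_square algebra_simps power_add power_mult)
      moreover have "3 ^ (e + 2) * 3 dvd 3 ^ (e + 2) * (s + x\<^sup>2 * y)"
        using y True by (intro mult_dvd_mono) auto
      ultimately have "3 ^ (e + 3) dvd (x + h) ^ 3 - a"
        by (simp add: power_add dvd_add)
      then have "q ^ (A + Suc i) dvd (x + h) ^ 3 - a" using e True by (simp add: numeral_3_eq_3)
      moreover have "q ^ (A - 1) dvd h" unfolding h_def True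
        using e A by (intro dvd_mult2 le_imp_power_dvd) auto
      then have "q ^ (A - 1) dvd (x + h) - 1" using x(2) by (metis add_diff_eq diff_add_eq dvd_add)
      ultimately show ?thesis by blast
    qed
  qed
  then obtain x where x: "q ^ (A + N) dvd x ^ 3 - a" "q ^ (A - 1) dvd x - 1" by blast
  moreover have "q ^ N dvd q ^ (A + N)" by (intro le_imp_power_dvd) auto
  ultimately show ?thesis using dvd_trans by blast
qed

lemma diff_dvd_word_value_diff: "x - y dvd word_value d w x - word_value d w (y::int)"
proof (induction w)
  case (Cons c w)
  have "word_value d w x - word_value d w y dvd word_value d w x ^ d - word_value d w y ^ d"
    by (metis power_diff_sumr2 dvd_triv_left)
  with Cons show ?case using dvd_trans by auto
qed simp

text \<open>
  A root of the \<open>i\<close>-th iterate of \<open>x ^ 3 + a\<close>, to any \<open>q\<close>-adic accuracy, of the form \<open>b\<close> plus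
  \<open>n ^ (3 ^ (j - i))\<close> times a unit close to \<open>1\<close>. If \<open>z\<close> is such a root, the next one is a cube root of
  \<open>z - a = (z - b) + b ^ 3\<close>, and this number is again a cube times a unit close to \<open>1\<close> as long as the
  exponent of \<open>n\<close> is divisible by three.
\<close>

lemma padic_root_of_iterate:
  fixes q n b a :: int
  assumes q: "prime q" "q dvd n" "n \<noteq> 0" and b: "b = - (n ^ (3 ^ j))" and a: "a = b - b ^ 3" and ij: "i \<le> j"
  shows "\<exists>u. q ^ (j - i + 1) dvd u - 1 \<and> q ^ N dvd word_value 3 (replicate i a) (b + n ^ (3 ^ (j - i)) * u)"
  using ij
proof (induction i)
  case 0
  show ?case by (rule exI[of _ 1]) (simp add: b)
next
  case (Suc i)
  then obtain u where u: "q ^ (j - i + 1) dvd u - 1"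
    "q ^ N dvd word_value 3 (replicate i a) (b + n ^ (3 ^ (j - i)) * u)" by auto
  define m where "m = (3::nat) ^ (j - Suc i)"
  have ji: "j - i = Suc (j - Suc i)" using Suc.prems by simp
  have m3: "3 ^ (j - i) = 3 * m" unfolding ji m_def by simp
  have jm: "3 ^ j = 3 ^ Suc i * m" using Suc.prems by (simp add: m_def flip: power_add power_Suc)
  have lin: "k < 3 ^ k" for k :: nat by (rule power_gt_expt) simp
  have mj: "m \<ge> j - i"
    using lin[of "j - Suc i"] ji unfolding m_def by simp
  have "m \<ge> 1" by (simp add: m_def)
  moreover have "3 * m \<le> 3 ^ j" unfolding jm by (simp add: mult_le_mono1)
  ultimately have E2: "j - i \<le> 3 ^ j - m" and E3: "j - i + 1 \<le> 3 ^ Suc j - 3 * m"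
    and E4: "3 * m + (3 ^ Suc j - 3 * m) = 3 ^ Suc j" "m + (3 ^ j - m) = 3 ^ j"
    using mj by auto
  have qpow: "q ^ k dvd n ^ l" if "k \<le> l" for k l
    using that q(2) by (meson dvd_power_le dvd_trans le_imp_power_dvd dvd_power_same)
  \<comment> \<open>\<open>z - a\<close> for the root \<open>z\<close> given by \<open>u\<close>, divided by \<open>n ^ (3 * m)\<close>\<close>
  define W where "W = u - n ^ (3 ^ Suc j - 3 * m)"
  have "q ^ (j - i + 1) dvd (u - 1) - n ^ (3 ^ Suc j - 3 * m)"
    using u(1) qpow[OF E3] by (rule dvd_diff)
  then have W: "q ^ (j - i + 1) dvd W - 1" by (simp add: W_def algebra_simps)
  obtain x where x: "q ^ N dvd x ^ 3 - W" "q ^ (j - i) dvd x - 1"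
    using cube_root_mod_prime_power[OF q(1) _ W, of N] ji by auto
  define u' where "u' = x + n ^ (3 ^ j - m)"
  have nb: "n ^ m * n ^ (3 ^ j - m) = - b" using E4(2) by (simp add: b flip: power_add)
  have z': "b + n ^ m * u' = n ^ m * x"
    unfolding u'_def distrib_left nb by simp
  have nb3: "n ^ (3 * m) * n ^ (3 ^ Suc j - 3 * m) = - (b ^ 3)"
    using E4(1) by (simp add: b flip: power_add) (simp add: power_mult[symmetric] mult.commute)
  have "(n ^ m * x) ^ 3 + a - (b + n ^ (3 * m) * u) = n ^ (3 * m) * (x ^ 3 - W) - (n ^ (3 * m) * n ^ (3 ^ Suc j - 3 * m)) - b ^ 3"
    by (simp add: W_def a algebra_simps power_mult_distrib power_mult[symmetric] mult.commute)
  then have "(n ^ m * x) ^ 3 + a - (b + n ^ (3 * m) * u) = n ^ (3 * m) * (x ^ 3 - W)" using nb3 by simp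
  then have c1: "q ^ N dvd (n ^ m * x) ^ 3 + a - (b + n ^ (3 * m) * u)" using x(1) by simp
  have "q ^ N dvd word_value 3 (replicate i a) ((n ^ m * x) ^ 3 + a) - word_value 3 (replicate i a) (b + n ^ (3 * m) * u)"
    using c1 diff_dvd_word_value_diff dvd_trans by blast
  then have "q ^ N dvd word_value 3 (replicate i a) ((n ^ m * x) ^ 3 + a)"
    using u(2) unfolding m3 by (metis dvd_add diff_add_cancel)
  moreover have "replicate (Suc i) a = replicate i a @ [a]" by (simp add: replicate_append_same)
  ultimately have "q ^ N dvd word_value 3 (replicate (Suc i) a) (b + n ^ m * u')"
    unfolding z' by (simp only: word_value_append) simp
  moreover have "q ^ (j - i) dvd u' - 1"
    using dvd_add[OF x(2) qpow[OF E2]] by (simp add: u'_def algebra_simps)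
  ultimately show ?case using ji by (auto simp: m_def)
qed

lemma multiplicity_of_cube:
  fixes q x y :: int
  assumes q: "prime q" and x: "x \<noteq> 0" "multiplicity q x < N" and dvd: "q ^ N dvd y ^ 3 - x"
  shows "3 dvd multiplicity q x"
proof -
  let ?m = "multiplicity q x"
  have nu: "\<not> is_unit q" using q not_prime_unit by blast
  have d1: "q ^ Suc ?m dvd y ^ 3 - x" using dvd x(2) by (meson Suc_leI dvd_trans le_imp_power_dvd)
  have nd: "\<not> q ^ Suc ?m dvd x" using x(1) nu by (simp add: power_dvd_iff_le_multiplicity del: power_Suc)
  have "q ^ ?m dvd (y ^ 3 - x) + x" by (intro dvd_add multiplicity_dvd dvd_trans[OF _ d1] le_imp_power_dvd) simp
  moreover have "\<not> q ^ Suc ?m dvd y ^ 3"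
    using nd d1 by (metis dvd_diff_right_iff dvd_diff_commute)
  ultimately have "multiplicity q (y ^ 3) = ?m" by (intro multiplicity_eqI) auto
  moreover have "y \<noteq> 0" using \<open>\<not> q ^ Suc ?m dvd y ^ 3\<close> by auto
  ultimately show ?thesis
    using prime_elem_multiplicity_power_distrib[of q y 3] q by (metis dvd_triv_left prime_elem_multiplicity_power_distrib prime_imp_prime_elem)
qed

lemma iterated_cube_root:
  fixes c :: int
  assumes "2 \<le> \<bar>c\<bar>"
  shows "\<exists>j n. c = n ^ (3 ^ j) \<and> (\<forall>y. n \<noteq> y ^ 3)"
  using assms
proof (induction "nat \<bar>c\<bar>" arbitrary: c rule: less_induct)
  case less
  show ?case
  proof (cases "\<exists>y. c = y ^ 3")
    case False
    then show ?thesis by (intro exI[of _ 0] exI[of _ c]) simp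
  next
    case True
    then obtain y where y: "c = y ^ 3" by blast
    have y2: "2 \<le> \<bar>y\<bar>"
    proof (rule ccontr)
      assume "\<not> 2 \<le> \<bar>y\<bar>"
      then have "y = 0 \<or> y = 1 \<or> y = -1" by auto
      then show False using y less(2) by auto
    qed
    have "\<bar>y\<bar> ^ 1 < \<bar>y\<bar> ^ 3" using y2 by (intro power_strict_increasing) auto
    then have "\<bar>y\<bar> < \<bar>c\<bar>" by (simp add: y power_abs)
    then have "nat \<bar>y\<bar> < nat \<bar>c\<bar>" by linarith
    then obtain j n where "y = n ^ (3 ^ j)" "\<forall>z. n \<noteq> z ^ 3" using less(1)[of y] y2 by auto
    then show ?thesis using y by (intro exI[of _ "Suc j"] exI[of _ n]) (simp add: power_mult[symmetric] mult.commute)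
  qed
qed

text \<open>
  Otherwise \<open>z - b\<close> is a cube in the field generated by a root \<open>z\<close> of the \<open>j\<close>-th iterate of
  \<open>x ^ 3 + a\<close>. Evaluate this relation, with denominators cleared, at a \<open>q\<close>-adic approximation of a
  root for which \<open>z - b\<close> is \<open>n\<close> times a unit: then three divides the multiplicity of \<open>q\<close> in \<open>n\<close>. Since
  \<open>n\<close> is not a cube, some prime \<open>q\<close> contradicts this.
\<close>

lemma irreducible_iterate_append:
  fixes a b n :: int
  assumes n: "\<And>y. n \<noteq> y ^ 3" and b: "b = - (n ^ (3 ^ j))" and a: "a = b - b ^ 3"
    and irr: "irreducible (word_poly 3 (replicate j a))"
  shows "irreducible (word_poly 3 (replicate j a @ [b]))"
proof (rule ccontr)
  assume red: "\<not> irreducible (word_poly 3 (replicate j a @ [b]))"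
  define f where "f = word_poly 3 (replicate j a)"
  define h where "h = pcompose f [:of_int b, 1:]"
  have h: "irreducible h" unfolding h_def f_def by (rule irreducible_translate[OF irr])
  have "word_poly 3 (replicate j a @ [b]) = pcompose h (monom 1 3)"
    by (simp add: word_poly_append h_def f_def binomial_poly_def pcompose_assoc[symmetric] pcompose_pCons add.commute)
  then obtain r where "h dvd r ^ 3 - [:0, 1:]" using cube_root_in_root_field[OF h] red by auto
  then obtain w where w: "r ^ 3 - [:0, 1:] = h * w" by (elim dvdE)
  obtain M1 where M1: "M1 \<noteq> 0" "\<And>z::int. \<exists>y::int. of_int M1 * poly r (of_int z) = of_int y"
    using common_denominator by blast
  obtain M2 where M2: "M2 \<noteq> 0" "\<And>z::int. \<exists>y::int. of_int M2 * poly w (of_int z) = of_int y"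
    using common_denominator by blast
  define M where "M = M1 * M2"
  have n0: "n \<noteq> 0" using n[of 0] by auto
  have "\<not> is_nth_power 3 (normalize n)"
  proof
    assume "is_nth_power 3 (normalize n)"
    then obtain y where "\<bar>n\<bar> = y ^ 3" by (auto simp: is_nth_power_def)
    then have "n = y ^ 3 \<or> n = (- y) ^ 3" by (auto simp: abs_if power3_eq_cube split: if_splits)
    then show False using n by blast
  qed
  then obtain q where q: "prime q" "\<not> 3 dvd multiplicity q n"
    using is_nth_power_conv_multiplicity[of 3 n] by auto
  have qn: "q dvd n" using q(2) by (metis dvd_0_right not_dvd_imp_multiplicity_0)
  \<comment> \<open>an accuracy that exceeds the multiplicity of \<open>q\<close> in the number to be recognized as a cube\<close>
  define N where "N = Suc (multiplicity q (M ^ 3 * n))"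
  obtain u where u: "q dvd u - 1" "q ^ N dvd word_value 3 (replicate j a) (b + n * u)"
    using padic_root_of_iterate[OF q(1) qn n0 b a order.refl, of N] by auto
  define z where "z = n * u"
  have hz: "poly h (of_int z) = of_int (word_value 3 (replicate j a) (b + z))"
    using poly_word_poly[of 3 "replicate j a" "b + z"] by (simp add: h_def f_def poly_pcompose)
  obtain y1 where y1: "of_int M1 * poly r (of_int z) = (of_int y1 :: rat)" using M1(2) by blast
  obtain y2 where y2: "of_int M2 * poly w (of_int z) = (of_int y2 :: rat)" using M2(2) by blast
  define y where "y = M2 * y1"
  have "of_int (y ^ 3 - M ^ 3 * z) = of_int (M2 ^ 3) * (of_int M1 * poly r (of_int z)) ^ 3 - (of_int (M ^ 3) * of_int z :: rat)"
    unfolding y1 by (simp add: y_def power_mult_distrib)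
  also have "\<dots> = of_int (M ^ 3) * poly (r ^ 3 - [:0, 1:]) (of_int z)"
    by (simp add: M_def power_mult_distrib algebra_simps)
  also have "\<dots> = poly h (of_int z) * of_int (M ^ 2 * M1) * (of_int M2 * poly w (of_int z))"
    unfolding w by (simp add: M_def power3_eq_cube power2_eq_square algebra_simps)
  also have "\<dots> = of_int (word_value 3 (replicate j a) (b + z) * (M ^ 2 * M1) * y2)"
    unfolding y2 hz by simp
  finally have "y ^ 3 - M ^ 3 * z = word_value 3 (replicate j a) (b + z) * (M ^ 2 * M1) * y2"
    by (simp only: of_int_eq_iff)
  then have "q ^ N dvd y ^ 3 - M ^ 3 * z" using u(2) by (simp add: z_def)
  moreover have uq: "\<not> q dvd u"
  proof
    assume "q dvd u"
    then have "q dvd u - (u - 1)" using u(1) by (rule dvd_diff)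
    then show False using q(1) by (simp add: not_prime_unit)
  qed
  have u0: "u \<noteq> 0" using uq by auto
  have pe: "prime_elem q" using q(1) by auto
  have M0: "M \<noteq> 0" using M1 M2 by (simp add: M_def)
  have mz: "multiplicity q (M ^ 3 * z) = 3 * multiplicity q M + multiplicity q n"
    using M0 n0 u0 uq pe
    by (simp add: z_def prime_elem_multiplicity_mult_distrib prime_elem_multiplicity_power_distrib not_dvd_imp_multiplicity_0)
  moreover have "multiplicity q (M ^ 3 * n) = 3 * multiplicity q M + multiplicity q n"
    using M0 n0 pe by (simp add: prime_elem_multiplicity_mult_distrib prime_elem_multiplicity_power_distrib)
  moreover have "M ^ 3 * z \<noteq> 0" using M0 n0 u0 by (simp add: z_def)
  ultimately have "3 dvd 3 * multiplicity q M + multiplicity q n"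
    using multiplicity_of_cube[OF q(1), of "M ^ 3 * z" N y] by (simp add: N_def)
  then show False using q(2) by presburger
qed

text \<open>
  Here \<open>b\<close> is fixed by \<open>x ^ 3 + a\<close>, and the norm criterion fails for appending the letter \<open>b\<close> if \<open>b\<close>
  is a cube. If \<open>- b\<close> is the \<open>3 ^ j\<close>-th power of a number that is not a cube, then \<open>b\<close> can be appended
  to \<open>j\<close> letters \<open>a\<close>, or to one letter \<open>a\<close> if \<open>j = 0\<close>. Afterwards three more letters \<open>a\<close> move every integer to \<open>b\<close> or to
  distance at least \<open>\<bar>a\<bar>\<close> from zero, and from there all values stay large.
\<close>

lemma irreducible_cone_cubic_pair:
  assumes a: "irreducible (binomial_poly 3 a)" "2 \<le> \<bar>a\<bar>" and b: "a = b - b ^ 3"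
  shows "\<exists>v\<in>lists {a, b}. irreducible_cone 3 {a, b} a v"
proof -
  have b2: "2 \<le> \<bar>b\<bar>"
  proof (rule ccontr)
    assume "\<not> 2 \<le> \<bar>b\<bar>"
    then have "b = 0 \<or> b = 1 \<or> b = -1" by auto
    then show False using a(2) b by auto
  qed
  then obtain j n where n: "- b = n ^ (3 ^ j)" "\<And>y. n \<noteq> y ^ 3" using iterated_cube_root[of "- b"] by auto
  have "\<exists>k. irreducible (word_poly 3 (a # replicate k a @ [b]))"
  proof (cases j)
    case 0
    have "avoids_powers 3 a (word_value 3 [] b)"
      unfolding avoids_powers_def
    proof (intro allI impI)
      fix p y assume "prime p" "p dvd (3::nat)"
      then have "p = 3" by (simp add: primes_dvd_imp_eq)
      moreover have "n \<noteq> (- y) ^ 3" by (rule n(2))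
      then have "b \<noteq> y ^ 3" using n(1) 0 by (simp add: power_minus_odd)
      ultimately show "word_value 3 [] b ^ 3 + a \<noteq> y ^ p" using b by simp
    qed
    then have "irreducible (word_poly 3 (a # [] @ [b]))"
      using a by (intro irreducible_word_append_letter) auto
    then show ?thesis by (intro exI[of _ 0]) simp
  next
    case (Suc k)
    have "irreducible (word_poly 3 (replicate j a))"
      using irreducible_word_replicate[of 3 a k] a Suc by simp
    then have "irreducible (word_poly 3 (replicate j a @ [b]))"
      using irreducible_iterate_append[OF n(2) _ b, of j] n(1) by simp
    then show ?thesis using Suc by auto
  qed
  then obtain k where k: "irreducible (word_poly 3 (a # (replicate k a @ [b])))" by auto
  have big: "\<bar>a\<bar> \<le> \<bar>word_value 3 (replicate k a @ [b]) x\<bar>" if "\<bar>a\<bar> \<le> \<bar>x\<bar> \<or> x = b" for x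
  proof -
    have "\<bar>a\<bar> \<le> \<bar>x ^ 3 + b\<bar>"
    proof (cases "x = b")
      case True
      have "\<bar>1 - b ^ 2\<bar> \<le> \<bar>b ^ 2 + 1\<bar>" using zero_le_power2[of b] by linarith
      then have "\<bar>b\<bar> * \<bar>1 - b ^ 2\<bar> \<le> \<bar>b\<bar> * \<bar>b ^ 2 + 1\<bar>" by (intro mult_left_mono) auto
      moreover have "b * (1 - b ^ 2) = b - b ^ 3" "b * (b ^ 2 + 1) = b ^ 3 + b"
        by (simp_all add: power3_eq_cube power2_eq_square algebra_simps)
      ultimately have "\<bar>b - b ^ 3\<bar> \<le> \<bar>b ^ 3 + b\<bar>" by (metis abs_mult)
      then show ?thesis using True b by simp
    next
      case False
      have "2 * 2 * \<bar>b\<bar> \<le> \<bar>b\<bar> * \<bar>b\<bar> * \<bar>b\<bar>" using b2 by (intro mult_mono) auto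
      then have "4 * \<bar>b\<bar> \<le> \<bar>b ^ 3\<bar>" by (simp add: power3_eq_cube abs_mult)
      then have ab: "\<bar>b\<bar> \<le> \<bar>a\<bar>" unfolding b by linarith
      have "\<bar>x\<bar> * 2 * 2 \<le> \<bar>x\<bar> * \<bar>x\<bar> * \<bar>x\<bar>" using that False a(2) by (intro mult_mono) auto
      then have "4 * \<bar>x\<bar> \<le> \<bar>x ^ 3\<bar>" by (simp add: power3_eq_cube abs_mult)
      then show ?thesis using that False ab by linarith
    qed
    then show ?thesis
      using word_value_replicate_large[of 3 a "x ^ 3 + b" k] a(2) by (simp add: word_value_append)
  qed
  have "irreducible_cone 3 {a, b} a ((replicate k a @ [b]) @ replicate 3 a)"
  proof (rule irreducible_coneI)
    show "irreducible (word_poly 3 (a # (replicate k a @ [b]) @ replicate 3 a))"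
    proof (rule irreducible_word_append[OF _ k])
      fix x c y assume "replicate 3 a = x @ c # y"
      then have "\<bar>a\<bar> \<le> \<bar>word_value 3 x c\<bar>"
        using word_value_prefix_large[of 3 a 3 x c y] a(2) by simp
      then show "avoids_powers 3 a (word_value 3 (replicate k a @ [b]) (word_value 3 x c))"
        using big avoids_powers_large a(2) by simp
    qed simp
    fix w j
    let ?t = "word_value 3 (replicate 3 a) (word_value 3 w j)"
    have "\<bar>a\<bar> \<le> \<bar>?t\<bar> \<or> ?t = b"
    proof (rule disjCI)
      assume "?t \<noteq> b"
      show "\<bar>a\<bar> \<le> \<bar>?t\<bar>"
      proof (rule ccontr)
        assume "\<not> \<bar>a\<bar> \<le> \<bar>?t\<bar>"
        then have "a = ?t - ?t ^ 3"
          using small_third_word_value[OF _ a(2) refl, of 3 "word_value 3 w j"] by auto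
        then show False using fixed_point_unique[of 3 a b ?t] b a(2) \<open>?t \<noteq> b\<close> by auto
      qed
    qed
    then show "avoids_powers 3 a (word_value 3 ((replicate k a @ [b]) @ replicate 3 a) (word_value 3 w j))"
      using big avoids_powers_large[of 3 a] a(2) by (simp only: word_value_append[of _ "replicate k a @ [b]"])
  qed simp
  then show ?thesis by (rule bexI) auto
qed

section \<open>Existence of a cone\<close>

text \<open>
  The exceptional constants for the base letter \<open>a = b - b ^ d\<close> are \<open>a\<close> and \<open>b\<close>, and for even \<open>d\<close>
  also \<open>- b\<close> and \<open>- b - b ^ d\<close>. So five constants for even \<open>d\<close> and three for odd \<open>d\<close> leave room for a
  further letter. In degree three the constants may be just \<open>a\<close> and \<open>b\<close>, the exceptional cubic pair.
\<close>

theorem irreducible_cone_exists: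
  assumes d: "d \<ge> 2" and fin: "finite S" and a: "a \<in> S" "irreducible (binomial_poly d a)"
    and odd: "d \<ge> 5 \<Longrightarrow> odd d \<Longrightarrow> 3 \<le> card S" and even: "d \<ge> 4 \<Longrightarrow> even d \<Longrightarrow> 5 \<le> card S"
  shows "\<exists>a\<in>S. \<exists>v\<in>lists S. irreducible_cone d S a v"
proof (cases "d = 2")
  case True
  then show ?thesis using irreducible_cone_quadratic a by blast
next
  case False
  then have d3: "d \<ge> 3" using d by simp
  have in_S: "\<exists>a\<in>S. \<exists>v\<in>lists S. irreducible_cone d S a v"
    if "irreducible_cone d S a (replicate 3 a @ w)" "w \<in> lists S" for w
    using that a(1) by (intro bexI[of _ a] bexI[of _ "replicate 3 a @ w"]) auto
  show ?thesis
  proof (cases "2 \<le> \<bar>a\<bar>")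
    case small: False
    then have "a = 1" "even d" using irreducible_binomial_constant[OF d a(2)] by auto
    then have "irreducible_cone d S a [a]" using a d by (intro irreducible_cone_positive) auto
    then show ?thesis using a(1) by (intro bexI) auto
  next
    case large: True
    show ?thesis
    proof (cases "\<exists>t. a = t - t ^ d")
      case False
      then show ?thesis
        using in_S[of "[]"] irreducible_cone_without_fixed_point[OF d3 a(2) large] by auto
    next
      case True
      then obtain b where b: "a = b - b ^ d" by blast
      show ?thesis
      proof (cases "\<exists>c\<in>S. c \<noteq> a \<and> c \<noteq> b \<and> (even d \<longrightarrow> c \<noteq> - b \<and> c \<noteq> - b - b ^ d)")
        case True
        then obtain c where c: "c \<in> S" "c \<noteq> a" "c \<noteq> b" "even d \<Longrightarrow> c \<noteq> - b" "even d \<Longrightarrow> c \<noteq> - b - b ^ d"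
          by blast
        then obtain w where "w \<in> lists {a, c}" "irreducible_cone d S a (replicate 3 a @ w)"
          using irreducible_cone_escaping_fixed_point[OF d3 a(2) large b c(2-5), of S] by blast
        moreover have "lists {a, c} \<subseteq> lists S" using a(1) c(1) by (intro lists_mono) auto
        ultimately show ?thesis using in_S by blast
      next
        case none: False
        have "odd d"
        proof
          assume ev: "even d"
          then have "S \<subseteq> {a, b, - b, - b - b ^ d}" using none by auto
          then have "card S \<le> card {a, b, - b, - b - b ^ d}" by (intro card_mono) auto
          also have "\<dots> \<le> 4" by (simp add: card_insert_if)
          finally show False using even ev d3 by (cases "d = 3") auto
        qed
        then have sub: "S \<subseteq> {a, b}" using none by auto
        show ?thesis
        proof (cases "S = {a}")
          case True
          have "irreducible_cone d S a []"
          proof (rule irreducible_coneI)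
            fix w j assume w: "w \<in> lists S" and j: "j \<in> S"
            then have "w = replicate (length w) a" using True by (auto intro: replicate_eqI)
            then have "\<bar>a\<bar> \<le> \<bar>word_value d w j\<bar>"
              using word_value_replicate_large[OF d large, of a "length w"] j True by auto
            then show "avoids_powers d a (word_value d [] (word_value d w j))"
              using avoids_powers_large[of d a] d large by simp
          qed (use a d in auto)
          then show ?thesis using a(1) by (intro bexI) auto
        next
          case False
          then have S: "S = {a, b}" using sub a(1) by blast
          have "card {a, b} \<le> 2" by (simp add: card_insert_if)
          then have "\<not> d \<ge> 5" using odd \<open>odd d\<close> S by auto
          then have "d = 3" using \<open>odd d\<close> d3 by (cases "d = 4") auto
          then show ?thesis
            using irreducible_cone_cubic_pair[of a b] a b large S by auto
        qed
      qed
    qed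
  qed
qed

section \<open>Counting words\<close>

lemma compositional_semigroup_eq_words:
  "compositional_semigroup (binomial_poly d ` S) = word_poly d ` {w \<in> lists S. w \<noteq> []}"
proof (intro equalityI subsetI)
  fix g assume "g \<in> compositional_semigroup (binomial_poly d ` S)"
  then show "g \<in> word_poly d ` {w \<in> lists S. w \<noteq> []}"
  proof induction
    case (generator f)
    then obtain c where "c \<in> S" "f = word_poly d [c]" by auto
    then show ?case by (intro image_eqI[of _ _ "[c]"]) auto
  next
    case (compose f g)
    then obtain u w where "f = word_poly d u" "u \<in> lists S" "u \<noteq> []" "g = word_poly d w" "w \<in> lists S" by blast
    then show ?case by (intro image_eqI[of _ _ "u @ w"]) (auto simp: word_poly_append)
  qed
next
  fix g assume "g \<in> word_poly d ` {w \<in> lists S. w \<noteq> []}"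
  then obtain w where w: "w \<in> lists S" "w \<noteq> []" "g = word_poly d w" by blast
  have "word_poly d w \<in> compositional_semigroup (binomial_poly d ` S)"
    using w(2,1)
  proof (induction w rule: list_nonempty_induct)
    case (single c)
    then show ?case by (auto intro: compositional_semigroup.generator)
  next
    case (cons c w)
    then show ?case
      by (auto intro!: compositional_semigroup.compose intro: compositional_semigroup.generator)
  qed
  then show "g \<in> compositional_semigroup (binomial_poly d ` S)" using w by simp
qed

text \<open>
  The cofactor of \<open>p - q\<close> in \<open>p ^ d - q ^ d\<close> is a sum of \<open>d\<close> monic polynomials of the same positive
  degree, and so it has positive degree.
\<close>

lemma monic_eq_if_power_diff_const:
  fixes p q :: "rat poly"
  assumes "lead_coeff p = 1" "lead_coeff q = 1" "degree p = degree q" "degree p > 0" "d \<ge> 2"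
    and "degree (p ^ d - q ^ d) = 0"
  shows "p = q"
proof (rule ccontr)
  assume "p \<noteq> q"
  define Q where "Q = (\<Sum>i<d. q ^ (d - Suc i) * p ^ i)"
  have nz: "p \<noteq> 0" "q \<noteq> 0" using assms(1,2) by auto
  have c: "coeff (q ^ (d - Suc i) * p ^ i) ((d - 1) * degree p) = 1" if "i < d" for i
  proof -
    have "degree (q ^ (d - Suc i) * p ^ i) = (d - Suc i) * degree p + i * degree p"
      using nz assms(3) by (simp add: degree_mult_eq degree_power_eq)
    also have "\<dots> = (d - 1) * degree p" using that by (simp flip: add_mult_distrib)
    finally have "coeff (q ^ (d - Suc i) * p ^ i) ((d - 1) * degree p) = lead_coeff (q ^ (d - Suc i) * p ^ i)"
      by simp
    also have "\<dots> = 1" by (simp only: lead_coeff_mult lead_coeff_power assms(1,2)) simp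
    finally show ?thesis .
  qed
  have "coeff Q ((d - 1) * degree p) = (\<Sum>i<d. 1)"
    unfolding Q_def coeff_sum by (intro sum.cong refl c) simp
  then have "coeff Q ((d - 1) * degree p) \<noteq> 0" using assms(5) by simp
  then have Q: "Q \<noteq> 0" "(d - 1) * degree p \<le> degree Q" by (auto intro: le_degree)
  have "p ^ d - q ^ d = (p - q) * Q" by (simp add: Q_def power_diff_sumr2)
  then have "degree (p ^ d - q ^ d) = degree (p - q) + degree Q"
    using \<open>p \<noteq> q\<close> Q by (simp add: degree_mult_eq)
  then have "(d - 1) * degree p = 0" using Q assms(6) by simp
  then show False using assms(4,5) by simp
qed

text \<open>
  The semigroup is free: the degree determines the length of a word, and the letters can be
  recovered from the outside.
\<close>

lemma word_poly_inject:
  assumes d: "d \<ge> 2" and eq: "word_poly d u = word_poly d w"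
  shows "u = w"
proof -
  have "d ^ length u = d ^ length w"
    using eq degree_word_poly[of d u] degree_word_poly[of d w] d by simp
  then have "length u = length w" using d by (simp add: power_inject_exp)
  then show ?thesis using eq
  proof (induction u w rule: list_induct2)
    case (Cons c u e w)
    let ?p = "word_poly d u" and ?q = "word_poly d w"
    have "?p ^ d + [:of_int c:] = ?q ^ d + [:of_int e:]"
      using Cons.prems by (simp add: binomial_poly_def pcompose_add pcompose_monom)
    then have "(?p ^ d + [:of_int c:]) - (?q ^ d + [:of_int c:]) = [:of_int e:] - [:of_int c:]" by simp
    then have diff: "?p ^ d - ?q ^ d = [:of_int e - of_int c:]" by simp
    have "?p = ?q"
    proof (rule monic_eq_if_power_diff_const[of _ _ d])
      show "lead_coeff ?p = 1" "lead_coeff ?q = 1" using monic_word_poly d by auto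
    qed (use d diff Cons.hyps in auto)
    then show ?case using diff Cons.IH by simp
  qed simp
qed

text \<open>
  Let \<open>E\<close> be the set of words \<open>w\<close> such that \<open>a # v @ w\<close> belongs to a polynomial of degree at most \<open>B\<close>.
  Removing the first \<open>L = length (a # v)\<close> letters of an arbitrary word yields an element of \<open>E\<close>,
  unless the word is short. So for large \<open>B\<close> the words up to degree \<open>B\<close> number at most a constant times
  the cardinality of \<open>E\<close>, while the elements of \<open>E\<close> give distinct irreducible polynomials.
\<close>

lemma positive_proportion_if_cone:
  assumes d: "d \<ge> 2" and S: "finite S" "a \<in> S" "v \<in> lists S" and cone: "irreducible_cone d S a v"
  shows "positive_proportion_irreducible (compositional_semigroup (binomial_poly d ` S))"
proof -
  define G where "G = compositional_semigroup (binomial_poly d ` S)"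
  define L where "L = Suc (length v)"
  define P where "P B = {w \<in> lists S. w \<noteq> [] \<and> d ^ length w \<le> B}" for B
  define E where "E B = {w \<in> lists S. d ^ (L + length w) \<le> B}" for B
  define K where "K = {w. set w \<subseteq> S \<and> length w \<le> L}"
  define U where "U = {u. set u \<subseteq> S \<and> length u = L}"
  define M where "M = card K + card U"
  have inj: "inj_on (word_poly d) A" for A by (rule inj_onI) (rule word_poly_inject[OF d])
  have total: "{g \<in> G. degree g \<le> B} = word_poly d ` P B" for B
    using d by (auto simp: G_def compositional_semigroup_eq_words P_def)
  have len: "n < d ^ n" for n using d by (intro power_gt_expt) auto
  have fin_P: "finite (P B)" for B
  proof (rule finite_subset)
    show "P B \<subseteq> {w. set w \<subseteq> S \<and> length w \<le> B}"
      using len by (auto simp: P_def intro: less_imp_le less_le_trans)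
  qed (rule finite_lists_length_le[OF S(1)])
  have fin_E: "finite (E B)" for B
  proof (rule finite_subset)
    show "E B \<subseteq> {w. set w \<subseteq> S \<and> length w \<le> B}"
    proof
      fix w assume "w \<in> E B"
      then have "w \<in> lists S" "L + length w < B" using len[of "L + length w"] by (auto simp: E_def)
      then show "w \<in> {w. set w \<subseteq> S \<and> length w \<le> B}" by auto
    qed
  qed (rule finite_lists_length_le[OF S(1)])
  have fin_K: "finite K" unfolding K_def by (rule finite_lists_length_le[OF S(1)])
  have fin_U: "finite U" unfolding U_def using finite_lists_length_eq[OF S(1)] by simp
  have card_total: "card (P B) \<le> M * card (E B)" if "E B \<noteq> {}" for B
  proof -
    have "P B \<subseteq> K \<union> (\<lambda>(u, w). u @ w) ` (U \<times> E B)"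
    proof
      fix w assume w: "w \<in> P B"
      show "w \<in> K \<union> (\<lambda>(u, w). u @ w) ` (U \<times> E B)"
      proof (cases "length w \<le> L")
        case True
        then show ?thesis using w by (auto simp: P_def K_def)
      next
        case False
        then have "take L w \<in> U" "drop L w \<in> E B"
          using w by (auto simp: P_def U_def E_def dest: in_set_takeD in_set_dropD)
        then show ?thesis by (intro UnI2 image_eqI[of _ _ "(take L w, drop L w)"]) auto
      qed
    qed
    then have "card (P B) \<le> card (K \<union> (\<lambda>(u, w). u @ w) ` (U \<times> E B))"
      using fin_K fin_U fin_E by (intro card_mono) auto
    also have "\<dots> \<le> card K + card ((\<lambda>(u, w). u @ w) ` (U \<times> E B))" by (rule card_Un_le)
    also have "card ((\<lambda>(u, w). u @ w) ` (U \<times> E B)) \<le> card U * card (E B)"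
      using card_image_le[of "U \<times> E B"] fin_U fin_E by (simp add: card_cartesian_product)
    also have "card K \<le> card K * card (E B)"
      using that fin_E[of B] by (simp add: Suc_leI card_gt_0_iff)
    finally show ?thesis by (simp add: M_def add_mult_distrib)
  qed
  have card_irr: "card (E B) \<le> card {g \<in> G. degree g \<le> B \<and> irreducible g}" for B
  proof -
    have "word_poly d ` (\<lambda>w. a # v @ w) ` E B \<subseteq> {g \<in> G. degree g \<le> B \<and> irreducible g}"
    proof (intro subsetI, elim imageE)
      fix g x w assume g: "g = word_poly d x" "x = a # v @ w" "w \<in> E B"
      then have "irreducible g" using cone by (auto simp: irreducible_cone_def E_def)
      moreover have "x \<in> P B" using g S by (auto simp: P_def E_def L_def)
      ultimately show "g \<in> {g \<in> G. degree g \<le> B \<and> irreducible g}"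
        using total[of B] g(1) by blast
    qed
    moreover have "finite {g \<in> G. degree g \<le> B \<and> irreducible g}"
      by (rule finite_subset[of _ "word_poly d ` P B"]) (use total[of B] fin_P in auto)
    ultimately have "card (word_poly d ` (\<lambda>w. a # v @ w) ` E B) \<le> card {g \<in> G. degree g \<le> B \<and> irreducible g}"
      by (intro card_mono)
    moreover have "inj_on (\<lambda>w. a # v @ w) (E B)" by (auto intro: inj_onI)
    ultimately show ?thesis by (simp add: card_image inj)
  qed
  have bound: "1 / real M \<le> real (card {g \<in> G. degree g \<le> B \<and> irreducible g}) / real (card {g \<in> G. degree g \<le> B})"
    if B: "d ^ L \<le> B" for B
  proof -
    have "[] \<in> E B" using B by (auto simp: E_def)
    then have E: "E B \<noteq> {}" by blast
    have "a # v \<in> P B" using B S by (auto simp: P_def L_def)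
    then have P: "card (P B) > 0" using fin_P[of B] by (auto simp: card_gt_0_iff)
    have T: "card {g \<in> G. degree g \<le> B} = card (P B)" by (simp add: total card_image inj)
    have "card (P B) \<le> M * card {g \<in> G. degree g \<le> B \<and> irreducible g}"
      using card_total[OF E] mult_le_mono2[OF card_irr[of B], of M] by linarith
    then have "real (card (P B)) \<le> real M * real (card {g \<in> G. degree g \<le> B \<and> irreducible g})"
      by (metis of_nat_le_iff of_nat_mult)
    moreover have "M > 0" using card_total[OF E] P by (cases "M = 0") auto
    ultimately show ?thesis using P unfolding T by (simp add: field_simps)
  qed
  have M: "M > 0"
  proof -
    have "[] \<in> K" by (simp add: K_def)
    then show ?thesis using fin_K by (auto simp: M_def card_gt_0_iff)
  qed
  have "ereal (1 / real M) \<le> liminf (\<lambda>B. ereal (real (card {g \<in> G. degree g \<le> B \<and> irreducible g}) / real (card {g \<in> G. degree g \<le> B})))"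
    by (rule Liminf_bounded) (use bound in \<open>auto intro: eventually_sequentiallyI[of "d ^ L"]\<close>)
  moreover have "0 < ereal (1 / real M)" using M by simp
  ultimately show ?thesis
    unfolding positive_proportion_irreducible_def G_def by (rule less_le_trans[rotated])
qed

theorem corollary1p2:
  fixes d s :: nat and c :: "nat \<Rightarrow> int" and G :: "rat poly set"
  assumes "d \<ge> 2"
    and "s \<ge> 1"
    and "inj_on c {1..s}"
    and "G = compositional_semigroup ((\<lambda>i. monom 1 d + [:of_int (c i):]) ` {1..s})"
    and "d \<ge> 5 \<and> odd d \<Longrightarrow> s \<ge> 3"
    and "d \<ge> 4 \<and> even d \<Longrightarrow> s \<ge> 5"
  shows "positive_proportion_irreducible G \<longleftrightarrow> (\<exists>g\<in>G. irreducible g)"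
proof
  assume pos: "positive_proportion_irreducible G"
  show "\<exists>g\<in>G. irreducible g"
  proof (rule ccontr)
    assume "\<not> (\<exists>g\<in>G. irreducible g)"
    then have none: "{g \<in> G. degree g \<le> B \<and> irreducible g} = {}" for B by blast
    show False using pos unfolding positive_proportion_irreducible_def none by (simp add: Liminf_const)
  qed
next
  define S where "S = c ` {1..s}"
  have G: "G = compositional_semigroup (binomial_poly d ` S)"
    using assms(4) by (simp add: S_def binomial_poly_def image_image)
  have card: "card S = s" using assms(3) by (simp add: S_def card_image)
  assume "\<exists>g\<in>G. irreducible g"
  then obtain w where w: "w \<in> lists S" "w \<noteq> []" "irreducible (word_poly d w)"
    unfolding G compositional_semigroup_eq_words by blast
  then obtain a u where au: "w = a # u" by (cases w) auto
  then have "a \<in> S" "irreducible (binomial_poly d a)"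
    using w irreducible_first_letter[of d a u] assms(1) by auto
  then obtain b v where "b \<in> S" "v \<in> lists S" "irreducible_cone d S b v"
    using irreducible_cone_exists[OF assms(1), of S a] assms(5,6) card by (auto simp: S_def)
  then show "positive_proportion_irreducible G"
    unfolding G using positive_proportion_if_cone[OF assms(1)] by (simp add: S_def)
qed

end
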